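(* Let $k$ be a finite field, let $P_1,\dots,P_N$ be distinct points of $\mathbf{P}^1(k)$, and let $h,e\ge0$ be integers with $2(h+e)<N$. There is an algorithm, using a number of arithmetic operations in $k$ polynomial in $N$, which, given $P_1,\dots,P_N$, $h$, $e$ and a word $(w_1,\dots,w_N)\in(\mathbf{P}^1(k))^N$ for which there exists a rational function $f\in k(x)$ of degree at most $h$ such that $f(P_i)=w_i$ for each $i$ with at most $e$ exceptions, finds such an $f$ (which is then unique).
   Context: $\mathbf{P}^1(k)=k\cup\{\infty\}$. The degree of a rational function $f=a/b\in k(x)$, with $a,b\in k[x]$ relatively prime, is $\max(\deg a,\deg b)$ (constants, including $0$, have degree $0$). Such an $f$ is evaluated as a map $\mathbf{P}^1(k)\to\mathbf{P}^1(k)$, taking the value $\infty$ at its poles. *)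

theory Defs
  imports "HOL-Algebra.Polynomial_Divisibility"
begin

section \<open>The projective line and rational functions over a field\<close>

datatype 'a proj_pt = Aff 'a | Infty

definition proj_line :: "'a ring \<Rightarrow> 'a proj_pt set" where
  "proj_line k = insert Infty (Aff ` carrier k)"

text \<open>
  Fields are records with an explicit carrier, because the statement quantifies over fields
  inside an existential quantifier over programs, which type classes do not allow. With an
  infinite element type such as \<open>nat\<close>, the carriers account for all finite fields up to isomorphism.
  The elements of \<open>k[X]\<close> are the coefficient lists of the library, highest coefficient first,
  with \<open>[]\<close> for zero; there \<open>degree p = length p - 1\<close>, so the degree of zero is 0.
  The library has no field of fractions for such records. As only the elements of \<open>k(X)\<close>
  matter here, and not its operations, \<open>k(X)\<close> is introduced as a set of equivalence classes.
\<close>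

definition frac_rel :: "'a ring \<Rightarrow> (('a list \<times> 'a list) \<times> ('a list \<times> 'a list)) set" where
  "frac_rel k =
     {((a, b), (c, d)).
        a \<in> carrier (poly_ring k) \<and> b \<in> carrier (poly_ring k) - {\<zero>\<^bsub>poly_ring k\<^esub>} \<and>
        c \<in> carrier (poly_ring k) \<and> d \<in> carrier (poly_ring k) - {\<zero>\<^bsub>poly_ring k\<^esub>} \<and>
        a \<otimes>\<^bsub>poly_ring k\<^esub> d = c \<otimes>\<^bsub>poly_ring k\<^esub> b}"

definition rat_funs :: "'a ring \<Rightarrow> ('a list \<times> 'a list) set set" where
  "rat_funs k =
     (carrier (poly_ring k) \<times> (carrier (poly_ring k) - {\<zero>\<^bsub>poly_ring k\<^esub>})) // frac_rel k"

text \<open>The fraction \<open>a / b\<close>. It is the empty set, hence not in \<open>rat_funs k\<close>, if \<open>b\<close> is zero.\<close>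

definition frac :: "'a ring \<Rightarrow> 'a list \<Rightarrow> 'a list \<Rightarrow> ('a list \<times> 'a list) set" where
  "frac k a b = frac_rel k `` {(a, b)}"

definition rel_prime :: "'a ring \<Rightarrow> 'a list \<Rightarrow> 'a list \<Rightarrow> bool" where
  "rel_prime k a b \<longleftrightarrow>
     (\<forall>d \<in> carrier (poly_ring k). d pdivides\<^bsub>k\<^esub> a \<longrightarrow> d pdivides\<^bsub>k\<^esub> b \<longrightarrow> d \<in> Units (poly_ring k))"

text \<open>
  A way to write \<open>f = a / b\<close> in lowest terms, unique up to a common constant factor, which
  affects neither the degree nor the values of \<open>f\<close>.
\<close>

definition lowest_terms :: "'a ring \<Rightarrow> ('a list \<times> 'a list) set \<Rightarrow> 'a list \<times> 'a list" where
  "lowest_terms k f = (SOME p. p \<in> f \<and> rel_prime k (fst p) (snd p))"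

definition rf_degree :: "'a ring \<Rightarrow> ('a list \<times> 'a list) set \<Rightarrow> nat" where
  "rf_degree k f = (case lowest_terms k f of (a, b) \<Rightarrow> max (degree a) (degree b))"

definition proj_quot :: "'a ring \<Rightarrow> 'a \<Rightarrow> 'a \<Rightarrow> 'a proj_pt" where
  "proj_quot k u v = (if v = \<zero>\<^bsub>k\<^esub> then Infty else Aff (u \<otimes>\<^bsub>k\<^esub> inv\<^bsub>k\<^esub> v))"

text \<open>
  At infinity, numerator and denominator are treated as polynomials of the same formal degree
  \<open>rf_degree k f\<close>, and \<open>f\<close> takes the quotient of their coefficients in that degree as its value.
\<close>

fun rf_eval :: "'a ring \<Rightarrow> ('a list \<times> 'a list) set \<Rightarrow> 'a proj_pt \<Rightarrow> 'a proj_pt" where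
  "rf_eval k f (Aff x) =
     (case lowest_terms k f of (a, b) \<Rightarrow> proj_quot k (ring.eval k a x) (ring.eval k b x))"
| "rf_eval k f Infty =
     (case lowest_terms k f of (a, b) \<Rightarrow>
        proj_quot k (ring.coeff k a (rf_degree k f)) (ring.coeff k b (rf_degree k f)))"

lemma lowest_terms_exists:
  assumes "field k" and "f \<in> rat_funs k"
  shows "\<exists>p. p \<in> f \<and> rel_prime k (fst p) (snd p)"
proof -
  interpret field k by fact
  interpret P: domain "poly_ring k"
    using univ_poly_is_domain[OF carrier_is_subring] .
  let ?P = "poly_ring k"
  obtain a0 b0 where f: "f = frac_rel k `` {(a0, b0)}"
    and ab0: "a0 \<in> carrier ?P" "b0 \<in> carrier ?P" "b0 \<noteq> \<zero>\<^bsub>?P\<^esub>"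
    using assms(2) unfolding rat_funs_def quotient_def by auto
  have "(a0, b0) \<in> f"
    using ab0 by (auto simp: f frac_rel_def)
  then obtain p where p: "p \<in> f" and min: "\<And>q. q \<in> f \<Longrightarrow> length (snd p) \<le> length (snd q)"
    using ex_has_least_nat[of "\<lambda>q. q \<in> f" "(a0, b0)" "\<lambda>q. length (snd q)"] by auto
  obtain a b where [simp]: "p = (a, b)" by force
  have ab: "a \<in> carrier ?P" "b \<in> carrier ?P" "b \<noteq> \<zero>\<^bsub>?P\<^esub>" "a0 \<otimes>\<^bsub>?P\<^esub> b = a \<otimes>\<^bsub>?P\<^esub> b0"
    using p by (auto simp: f frac_rel_def)
  have "rel_prime k a b"
    unfolding rel_prime_def
  proof (intro ballI impI)
    fix d assume d: "d \<in> carrier ?P" "d pdivides\<^bsub>k\<^esub> a" "d pdivides\<^bsub>k\<^esub> b"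
    then obtain a' b' where a': "a' \<in> carrier ?P" "a = d \<otimes>\<^bsub>?P\<^esub> a'"
      and b': "b' \<in> carrier ?P" "b = d \<otimes>\<^bsub>?P\<^esub> b'"
      unfolding pdivides_def factor_def by blast
    have nz: "d \<noteq> \<zero>\<^bsub>?P\<^esub>" "b' \<noteq> \<zero>\<^bsub>?P\<^esub>"
      using ab(3) b' d(1) by auto
    have "d \<otimes>\<^bsub>?P\<^esub> (a0 \<otimes>\<^bsub>?P\<^esub> b') = d \<otimes>\<^bsub>?P\<^esub> (a' \<otimes>\<^bsub>?P\<^esub> b0)"
      using ab(4) a' b' d(1) ab0 by (simp add: P.m_ac)
    hence "a0 \<otimes>\<^bsub>?P\<^esub> b' = a' \<otimes>\<^bsub>?P\<^esub> b0"
      using P.m_lcancel[OF nz(1) d(1)] a' b' ab0 by simp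
    hence "(a', b') \<in> f"
      using a' b' ab0 nz by (auto simp: f frac_rel_def)
    from min[OF this] have "length b \<le> length b'" by simp
    moreover have nil: "d \<noteq> []" "b' \<noteq> []"
      using nz by (auto simp: univ_poly_zero)
    moreover have "degree b = degree d + degree b'"
      using poly_mult_degree_eq[OF carrier_is_subring] d(1) b' nil
      by (simp add: univ_poly_mult univ_poly_carrier)
    ultimately have "degree d = 0"
      by linarith
    thus "d \<in> Units ?P"
      using univ_poly_units'[OF carrier_is_subfield] d(1) nil by blast
  qed
  with p show ?thesis by auto
qed

section \<open>Algebraic programs\<close>

text \<open>
  A program works on two kinds of storage: variables holding natural numbers, which control
  loops and address memory, and arrays of elements of the field \<open>k\<close>. The syntax does not
  mention \<open>k\<close>; a program can handle elements of \<open>k\<close> only by copying them, by the four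
  arithmetic operations and by testing two of them for equality.
\<close>

type_synonym vname = string

datatype nexp = Num nat | Var vname | NAdd nexp nexp | NSub nexp nexp | NMul nexp nexp

datatype bexp = BLess nexp nexp | BNot bexp | BAnd bexp bexp

type_synonym cell = "vname \<times> nexp"

datatype com =
    Skip
  | NSet vname nexp
  | FZero cell
  | FOne cell
  | FCopy cell cell
  | FAdd cell cell cell
  | FSub cell cell cell
  | FMul cell cell cell
  | FDiv cell cell cell
  | FEq vname cell cell
  | Seq com com
  | Cond bexp com com
  | While bexp com

type_synonym 'a state = "(vname \<Rightarrow> nat) \<times> (vname \<Rightarrow> nat \<Rightarrow> 'a)"

fun nval :: "nexp \<Rightarrow> (vname \<Rightarrow> nat) \<Rightarrow> nat" where
  "nval (Num n) \<nu> = n"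
| "nval (Var x) \<nu> = \<nu> x"
| "nval (NAdd a b) \<nu> = nval a \<nu> + nval b \<nu>"
| "nval (NSub a b) \<nu> = nval a \<nu> - nval b \<nu>"
| "nval (NMul a b) \<nu> = nval a \<nu> * nval b \<nu>"

fun bval :: "bexp \<Rightarrow> (vname \<Rightarrow> nat) \<Rightarrow> bool" where
  "bval (BLess a b) \<nu> \<longleftrightarrow> nval a \<nu> < nval b \<nu>"
| "bval (BNot b) \<nu> \<longleftrightarrow> \<not> bval b \<nu>"
| "bval (BAnd b c) \<nu> \<longleftrightarrow> bval b \<nu> \<and> bval c \<nu>"

fun nset :: "'a state \<Rightarrow> vname \<Rightarrow> nat \<Rightarrow> 'a state" where
  "nset (\<nu>, \<phi>) x n = (\<nu>(x := n), \<phi>)"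

fun fget :: "'a state \<Rightarrow> cell \<Rightarrow> 'a" where
  "fget (\<nu>, \<phi>) (A, i) = \<phi> A (nval i \<nu>)"

fun fset :: "'a state \<Rightarrow> cell \<Rightarrow> 'a \<Rightarrow> 'a state" where
  "fset (\<nu>, \<phi>) (A, i) v = (\<nu>, \<phi>(A := (\<phi> A)(nval i \<nu> := v)))"

text \<open>
  \<open>exec k c s n t\<close>: over the field \<open>k\<close>, program \<open>c\<close> started in state \<open>s\<close> terminates in state
  \<open>t\<close> after \<open>n\<close> arithmetic operations in \<open>k\<close>. Equality tests in \<open>k\<close> are counted as operations;
  copying, the constants 0 and 1, and natural-number bookkeeping are free.
  A division by zero blocks the execution.
\<close>

inductive exec :: "'a ring \<Rightarrow> com \<Rightarrow> 'a state \<Rightarrow> nat \<Rightarrow> 'a state \<Rightarrow> bool" for k :: "'a ring" where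
  Skip: "exec k Skip s 0 s"
| NSet: "exec k (NSet x a) s 0 (nset s x (nval a (fst s)))"
| FZero: "exec k (FZero l) s 0 (fset s l \<zero>\<^bsub>k\<^esub>)"
| FOne: "exec k (FOne l) s 0 (fset s l \<one>\<^bsub>k\<^esub>)"
| FCopy: "exec k (FCopy l l1) s 0 (fset s l (fget s l1))"
| FAdd: "exec k (FAdd l l1 l2) s 1 (fset s l (fget s l1 \<oplus>\<^bsub>k\<^esub> fget s l2))"
| FSub: "exec k (FSub l l1 l2) s 1 (fset s l (fget s l1 \<ominus>\<^bsub>k\<^esub> fget s l2))"
| FMul: "exec k (FMul l l1 l2) s 1 (fset s l (fget s l1 \<otimes>\<^bsub>k\<^esub> fget s l2))"
| FDiv: "fget s l2 \<noteq> \<zero>\<^bsub>k\<^esub> \<Longrightarrow>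
         exec k (FDiv l l1 l2) s 1 (fset s l (fget s l1 \<otimes>\<^bsub>k\<^esub> inv\<^bsub>k\<^esub> (fget s l2)))"
| FEq: "exec k (FEq x l1 l2) s 1 (nset s x (if fget s l1 = fget s l2 then 1 else 0))"
| Seq: "exec k c1 s m s' \<Longrightarrow> exec k c2 s' n t \<Longrightarrow> exec k (Seq c1 c2) s (m + n) t"
| CondTrue: "bval b (fst s) \<Longrightarrow> exec k c1 s n t \<Longrightarrow> exec k (Cond b c1 c2) s n t"
| CondFalse: "\<not> bval b (fst s) \<Longrightarrow> exec k c2 s n t \<Longrightarrow> exec k (Cond b c1 c2) s n t"
| WhileFalse: "\<not> bval b (fst s) \<Longrightarrow> exec k (While b c) s 0 s"
| WhileTrue: "bval b (fst s) \<Longrightarrow> exec k c s m s' \<Longrightarrow> exec k (While b c) s' n t \<Longrightarrow>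
              exec k (While b c) s (m + n) t"

section \<open>The decoding problem\<close>

definition decodings ::
  "'a ring \<Rightarrow> 'a proj_pt list \<Rightarrow> nat \<Rightarrow> nat \<Rightarrow> 'a proj_pt list \<Rightarrow> ('a list \<times> 'a list) set set" where
  "decodings k Ps h e ws =
     {f \<in> rat_funs k. rf_degree k f \<le> h \<and> card {i. i < length Ps \<and> rf_eval k f (Ps ! i) \<noteq> ws ! i} \<le> e}"

text \<open>Points of the projective line are handed to a program as \<open>(x : 1)\<close> or \<open>(1 : 0)\<close>.\<close>

fun coord0 :: "'a ring \<Rightarrow> 'a proj_pt \<Rightarrow> 'a" where
  "coord0 k (Aff x) = x"
| "coord0 k Infty = \<one>\<^bsub>k\<^esub>"

fun coord1 :: "'a ring \<Rightarrow> 'a proj_pt \<Rightarrow> 'a" where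
  "coord1 k (Aff x) = \<one>\<^bsub>k\<^esub>"
| "coord1 k Infty = \<zero>\<^bsub>k\<^esub>"

definition load :: "'a ring \<Rightarrow> 'a list \<Rightarrow> nat \<Rightarrow> 'a" where
  "load k xs = (\<lambda>i. if i < length xs then xs ! i else \<zero>\<^bsub>k\<^esub>)"

definition start_state ::
  "'a ring \<Rightarrow> 'a proj_pt list \<Rightarrow> nat \<Rightarrow> nat \<Rightarrow> 'a proj_pt list \<Rightarrow> 'a state" where
  "start_state k Ps h e ws =
     ((\<lambda>_. 0)(''N'' := length Ps, ''h'' := h, ''e'' := e),
      (\<lambda>_ _. \<zero>\<^bsub>k\<^esub>)
        (''P0'' := load k (map (coord0 k) Ps), ''P1'' := load k (map (coord1 k) Ps),
         ''w0'' := load k (map (coord0 k) ws), ''w1'' := load k (map (coord1 k) ws)))"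

text \<open>
  The result is read off as the quotient of the two polynomials of degree at most \<open>h\<close> whose
  coefficients stand in the cells \<open>0, \<dots>, h\<close> of the arrays \<open>a\<close> and \<open>b\<close>, constant
  coefficient first.
\<close>

definition read_poly :: "'a ring \<Rightarrow> nat \<Rightarrow> (nat \<Rightarrow> 'a) \<Rightarrow> 'a list" where
  "read_poly k h u = ring.normalize k (map u (rev [0..<Suc h]))"

definition result :: "'a ring \<Rightarrow> nat \<Rightarrow> 'a state \<Rightarrow> ('a list \<times> 'a list) set" where
  "result k h s = frac k (read_poly k h (snd s ''a'')) (read_poly k h (snd s ''b''))"

end

theory Submission
  imports Defs
begin

text \<open>
  A form of degree \<open>d\<close> in two variables has a value at each \<open>(x : y)\<close>, up to the choice of
  coordinates, and a nonzero one has at most \<open>d\<close> zeros on the projective line. A polynomial of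
  degree at most \<open>d\<close> is treated as such a form, which puts infinity on the same footing as the
  other points.

  Write \<open>P\<^sub>i\<close> for the points and \<open>(u\<^sub>i : v\<^sub>i)\<close> for the letters of the word. The key equation, in
  the style of Welch and Berlekamp, asks for forms \<open>A\<close>, \<open>B\<close> of degree \<open>h + e\<close>, not both zero, with
  \<open>A(P\<^sub>i) v\<^sub>i = B(P\<^sub>i) u\<^sub>i\<close> for all \<open>i\<close>; it is linear in the coefficients of \<open>A\<close> and \<open>B\<close>. If \<open>f = a / b\<close> is
  a decoding and \<open>E\<close> is a form vanishing at the positions of the errors, then \<open>(a E, b E)\<close> is a
  solution (\<open>decoding_exists_solution\<close>). Conversely let \<open>(A, B)\<close> be any solution. At each point where \<open>f\<close>
  agrees with the word, both pairs \<open>(A, B)\<close> and \<open>(a, b)\<close> are proportional to \<open>(u\<^sub>i, v\<^sub>i)\<close>, so that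
  \<open>A b - B a\<close>, a form of degree at most \<open>2 h + e\<close>, has at least \<open>N - e > 2 h + e\<close> zeros and
  therefore is zero (\<open>solution_cross_decoding\<close>). Hence every solution represents \<open>f\<close>, which also
  makes \<open>f\<close> unique.

  The output must have degree at most \<open>h\<close>, and \<open>A / B\<close> need not be in lowest terms. Instead of
  computing a greatest common divisor, the program solves a second system of the same shape:
  it looks for forms \<open>a\<close>, \<open>b\<close> of degree \<open>h\<close> with \<open>a(P\<^sub>i) B(P\<^sub>i) = b(P\<^sub>i) A(P\<^sub>i)\<close> for all \<open>i\<close>. Since
  \<open>N > 2 h + e\<close>, this implies \<open>a B = b A\<close>, whether or not \<open>A\<close> and \<open>B\<close> vanish together at some of
  the points (\<open>reduced_solution_eq_decoding\<close>).

  So a single subroutine is enough, which finds a nonzero solution of a solvable homogeneous system.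
  It keeps a family of vectors, at first the unit vectors. For a linear equation \<open>L = 0\<close> with
  \<open>L v\<^sub>p \<noteq> 0\<close> for some member \<open>v\<^sub>p\<close> of the family, it replaces each \<open>v\<^sub>j\<close> by
  \<open>L(v\<^sub>p) v\<^sub>j - L(v\<^sub>j) v\<^sub>p\<close>. The new vectors satisfy the equation, and those combinations of the old
  ones that satisfy it are combinations of the new ones (\<open>lspan_eliminate\<close>). No division is needed, and
  linear independence is not maintained: a nonzero solution stays in the span, so in the end some
  member of the family is nonzero, and each of them is a solution (\<open>wp_solve\<close>).

  Programs are handled by weakest preconditions that carry the operation count (\<open>wp\<close>), a rule
  for counting loops (\<open>wp_For\<close>), and a frame property read off from the syntax (\<open>wp_frame\<close>). With at most
  \<open>2 N\<close> unknowns and \<open>N\<close> equations, the count is cubic in \<open>N\<close>.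
\<close>

section \<open>Reasoning about programs\<close>

text \<open>
  The operation count is an argument of the postcondition, which lets sequential composition add up
  the costs and makes straight-line programs executable by rewriting.
\<close>

definition wp :: "'a ring \<Rightarrow> com \<Rightarrow> 'a state \<Rightarrow> (nat \<Rightarrow> 'a state \<Rightarrow> bool) \<Rightarrow> bool" where
  "wp k c s Q \<longleftrightarrow> (\<exists>n t. exec k c s n t \<and> Q n t)"

text \<open>States are accessed only by their projections, so quantifiers over states must not be split.\<close>

declare split_paired_Ex [simp del] split_paired_All [simp del]

lemma wpI: "exec k c s n t \<Longrightarrow> Q n t \<Longrightarrow> wp k c s Q"
  unfolding wp_def by blast

inductive_cases SkipE: "exec k Skip s n t"
inductive_cases NSetE: "exec k (NSet x a) s n t"
inductive_cases FZeroE: "exec k (FZero l) s n t"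
inductive_cases FOneE: "exec k (FOne l) s n t"
inductive_cases FCopyE: "exec k (FCopy l l1) s n t"
inductive_cases FAddE: "exec k (FAdd l l1 l2) s n t"
inductive_cases FSubE: "exec k (FSub l l1 l2) s n t"
inductive_cases FMulE: "exec k (FMul l l1 l2) s n t"
inductive_cases FEqE: "exec k (FEq x l1 l2) s n t"
inductive_cases SeqE: "exec k (Seq c1 c2) s n t"
inductive_cases CondE: "exec k (Cond b c1 c2) s n t"

lemmas exec_atomic = exec.Skip exec.NSet exec.FZero exec.FOne exec.FCopy
  exec.FAdd exec.FSub exec.FMul exec.FEq

lemma wp_atomic:
  assumes "exec k c s m u" "\<And>n t. exec k c s n t \<Longrightarrow> n = m \<and> t = u"
  shows "wp k c s Q \<longleftrightarrow> Q m u"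
  using assms unfolding wp_def by blast

lemma wp_simps [simp]:
  "wp k Skip s Q \<longleftrightarrow> Q 0 s"
  "wp k (NSet x a) s Q \<longleftrightarrow> Q 0 (nset s x (nval a (fst s)))"
  "wp k (FZero l) s Q \<longleftrightarrow> Q 0 (fset s l \<zero>\<^bsub>k\<^esub>)"
  "wp k (FOne l) s Q \<longleftrightarrow> Q 0 (fset s l \<one>\<^bsub>k\<^esub>)"
  "wp k (FCopy l l1) s Q \<longleftrightarrow> Q 0 (fset s l (fget s l1))"
  "wp k (FAdd l l1 l2) s Q \<longleftrightarrow> Q 1 (fset s l (fget s l1 \<oplus>\<^bsub>k\<^esub> fget s l2))"
  "wp k (FSub l l1 l2) s Q \<longleftrightarrow> Q 1 (fset s l (fget s l1 \<ominus>\<^bsub>k\<^esub> fget s l2))"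
  "wp k (FMul l l1 l2) s Q \<longleftrightarrow> Q 1 (fset s l (fget s l1 \<otimes>\<^bsub>k\<^esub> fget s l2))"
  "wp k (FEq x l1 l2) s Q \<longleftrightarrow> Q 1 (nset s x (if fget s l1 = fget s l2 then 1 else 0))"
  by (rule wp_atomic[OF exec_atomic(1)] wp_atomic[OF exec_atomic(2)] wp_atomic[OF exec_atomic(3)]
        wp_atomic[OF exec_atomic(4)] wp_atomic[OF exec_atomic(5)] wp_atomic[OF exec_atomic(6)]
        wp_atomic[OF exec_atomic(7)] wp_atomic[OF exec_atomic(8)] wp_atomic[OF exec_atomic(9)];
      auto elim: SkipE NSetE FZeroE FOneE FCopyE FAddE FSubE FMulE FEqE)+

lemma wp_Seq [simp]:
  "wp k (Seq c1 c2) s Q \<longleftrightarrow> wp k c1 s (\<lambda>m t. wp k c2 t (\<lambda>n u. Q (m + n) u))"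
  unfolding wp_def by (blast elim: SeqE intro: exec.Seq)

lemma wp_Cond [simp]:
  "wp k (Cond b c1 c2) s Q \<longleftrightarrow> (if bval b (fst s) then wp k c1 s Q else wp k c2 s Q)"
  unfolding wp_def by (auto elim!: CondE intro: exec.CondTrue exec.CondFalse)

lemma wp_mono:
  assumes "wp k c s P" "\<And>n t. P n t \<Longrightarrow> Q n t"
  shows "wp k c s Q"
  using assms unfolding wp_def by blast

lemma fst_nset [simp]: "fst (nset s x n) = (fst s)(x := n)"
  and snd_nset [simp]: "snd (nset s x n) = snd s"
  by (cases s; simp)+

lemma fst_fset [simp]: "fst (fset s (A, i) v) = fst s"
  and snd_fset [simp]: "snd (fset s (A, i) v) = (snd s)(A := (snd s A)(nval i (fst s) := v))"
  by (cases s; simp)+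

lemma fget_eq [simp]: "fget s (A, i) = snd s A (nval i (fst s))"
  by (cases s; simp)

subsection \<open>Frames\<close>

text \<open>
  The variables and the arrays that a program may change, as sets computed from its syntax:
  specifications then need to mention only what changes.
\<close>

primrec nwr :: "com \<Rightarrow> vname set" where
  "nwr Skip = {}"
| "nwr (NSet x a) = {x}"
| "nwr (FZero l) = {}"
| "nwr (FOne l) = {}"
| "nwr (FCopy l l1) = {}"
| "nwr (FAdd l l1 l2) = {}"
| "nwr (FSub l l1 l2) = {}"
| "nwr (FMul l l1 l2) = {}"
| "nwr (FDiv l l1 l2) = {}"
| "nwr (FEq x l1 l2) = {x}"
| "nwr (Seq c1 c2) = nwr c1 \<union> nwr c2"
| "nwr (Cond b c1 c2) = nwr c1 \<union> nwr c2"
| "nwr (While b c) = nwr c"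

primrec fwr :: "com \<Rightarrow> vname set" where
  "fwr Skip = {}"
| "fwr (NSet x a) = {}"
| "fwr (FZero l) = {fst l}"
| "fwr (FOne l) = {fst l}"
| "fwr (FCopy l l1) = {fst l}"
| "fwr (FAdd l l1 l2) = {fst l}"
| "fwr (FSub l l1 l2) = {fst l}"
| "fwr (FMul l l1 l2) = {fst l}"
| "fwr (FDiv l l1 l2) = {fst l}"
| "fwr (FEq x l1 l2) = {}"
| "fwr (Seq c1 c2) = fwr c1 \<union> fwr c2"
| "fwr (Cond b c1 c2) = fwr c1 \<union> fwr c2"
| "fwr (While b c) = fwr c"

definition frame :: "vname set \<Rightarrow> vname set \<Rightarrow> 'a state \<Rightarrow> 'a state \<Rightarrow> bool" where
  "frame Z W s t \<longleftrightarrow> (\<forall>x. x \<notin> Z \<longrightarrow> fst t x = fst s x) \<and> (\<forall>A. A \<notin> W \<longrightarrow> snd t A = snd s A)"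

lemma frameD:
  assumes "frame Z W s t"
  shows "x \<notin> Z \<Longrightarrow> fst t x = fst s x" and "A \<notin> W \<Longrightarrow> snd t A = snd s A"
  using assms by (auto simp: frame_def)

definition in_field :: "'a ring \<Rightarrow> 'a state \<Rightarrow> bool" where
  "in_field k s \<longleftrightarrow> (\<forall>A i. snd s A i \<in> carrier k)"

lemma in_fieldD [simp]: "in_field k s \<Longrightarrow> snd s A i \<in> carrier k"
  by (simp add: in_field_def)

lemma in_field_nset [simp]: "in_field k (nset s x n) = in_field k s"
  by (simp add: in_field_def)

lemma in_field_fset: "in_field k s \<Longrightarrow> v \<in> carrier k \<Longrightarrow> in_field k (fset s l v)"
  by (cases l) (auto simp: in_field_def)

lemma exec_frame: "exec k c s n t \<Longrightarrow> frame (nwr c) (fwr c) s t"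
proof (induction rule: exec.induct)
qed (auto simp: frame_def split: prod.splits)

lemma fget_in_field: "in_field k s \<Longrightarrow> fget s l \<in> carrier k"
  by (cases l) simp

lemma exec_in_field:
  assumes "field k"
  shows "exec k c s n t \<Longrightarrow> in_field k s \<Longrightarrow> in_field k t"
proof -
  interpret field k by fact
  show "exec k c s n t \<Longrightarrow> in_field k s \<Longrightarrow> in_field k t"
  proof (induction rule: exec.induct)
    case (FDiv s l2 l l1)
    then have "fget s l2 \<in> Units k"
      using fget_in_field[of k s l2] field_Units by auto
    then show ?case using FDiv by (intro in_field_fset) (auto intro: fget_in_field)
  qed (auto intro!: in_field_fset fget_in_field)
qed

lemma wp_frame:
  assumes "field k" "in_field k s" "wp k c s Q"
  shows "wp k c s (\<lambda>n t. Q n t \<and> frame (nwr c) (fwr c) s t \<and> in_field k t)"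
  using assms exec_frame exec_in_field unfolding wp_def by blast

subsection \<open>Counting loops\<close>

text \<open>The upper bound of a loop is a variable, as the frame of the body then keeps it constant.\<close>

definition For :: "vname \<Rightarrow> vname \<Rightarrow> com \<Rightarrow> com" where
  "For x y c = Seq (NSet x (Num 0))
     (While (BLess (Var x) (Var y)) (Seq c (NSet x (NAdd (Var x) (Num 1)))))"

lemma nwr_For [simp]: "nwr (For x y c) = insert x (nwr c)"
  and fwr_For [simp]: "fwr (For x y c) = fwr c"
  by (auto simp: For_def)

text \<open>
  The step may use the frame of the whole loop relative to the initial state \<open>s\<close>, so that an
  invariant \<open>I\<close> has to describe only the part of the state that the loop computes. The
  invariant is taken after the loop variable has been advanced.
\<close>

lemma wp_For:
  assumes k: "field k" and s: "in_field k s"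
    and x: "x \<noteq> y" "x \<notin> nwr c" "y \<notin> nwr c"
    and I0: "I 0 (nset s x 0)"
    and step: "\<And>j t. j < fst s y \<Longrightarrow> in_field k t \<Longrightarrow> frame (insert x (nwr c)) (fwr c) s t \<Longrightarrow>
       fst t x = j \<Longrightarrow> I j t \<Longrightarrow> wp k c t (\<lambda>n t'. n \<le> B \<and> I (Suc j) (nset t' x (Suc j)))"
  shows "wp k (For x y c) s (\<lambda>n t. n \<le> fst s y * B \<and> I (fst s y) t \<and>
     frame (insert x (nwr c)) (fwr c) s t \<and> in_field k t)"
proof -
  let ?w = "While (BLess (Var x) (Var y)) (Seq c (NSet x (NAdd (Var x) (Num 1))))"
  let ?F = "frame (insert x (nwr c)) (fwr c) s"
  have loop: "\<exists>n u. exec k ?w t n u \<and> n \<le> d * B \<and> I (fst s y) u \<and> ?F u \<and> in_field k u"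
    if "fst t x + d = fst s y" "in_field k t" "?F t" "I (fst t x) t" for d t
    using that
  proof (induction d arbitrary: t)
    case 0
    then have "fst t y = fst s y"
      using x by (auto simp: frame_def)
    then have "exec k ?w t 0 t"
      using 0 by (intro exec.WhileFalse) auto
    with 0 show ?case by auto
  next
    case (Suc d)
    have ty: "fst t y = fst s y"
      using x Suc.prems by (auto simp: frame_def)
    have "wp k c t (\<lambda>n t'. n \<le> B \<and> I (Suc (fst t x)) (nset t' x (Suc (fst t x))))"
      using Suc.prems by (intro step) auto
    from wp_frame[OF k Suc.prems(2) this] obtain n1 t1 where
      t1: "exec k c t n1 t1" "n1 \<le> B" "I (Suc (fst t x)) (nset t1 x (Suc (fst t x)))"
          "frame (nwr c) (fwr c) t t1" "in_field k t1"
      unfolding wp_def by blast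
    have t1x: "fst t1 x = fst t x"
      using t1(4) x by (auto simp: frame_def)
    let ?t2 = "nset t1 x (Suc (fst t x))"
    have e: "exec k (Seq c (NSet x (NAdd (Var x) (Num 1)))) t (n1 + 0) ?t2"
      using exec.Seq[OF t1(1) exec.NSet[of k x "NAdd (Var x) (Num 1)" t1]] t1x by simp
    have F2: "?F ?t2"
      using t1(4) Suc.prems(3) by (auto simp: frame_def)
    obtain n u where u: "exec k ?w ?t2 n u" "n \<le> d * B" "I (fst s y) u" "?F u" "in_field k u"
      using Suc.IH[of ?t2] Suc.prems t1 F2 by auto
    have "exec k ?w t (n1 + 0 + n) u"
      using exec.WhileTrue[OF _ e u(1)] Suc.prems(1) ty by simp
    then show ?case using u t1(2) by (intro exI[of _ "n1 + 0 + n"] exI[of _ u]) auto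
  qed
  have "\<exists>n u. exec k ?w (nset s x 0) n u \<and> n \<le> fst s y * B \<and> I (fst s y) u \<and> ?F u \<and> in_field k u"
    using I0 s by (intro loop) (auto simp: frame_def)
  then obtain n u where u: "exec k ?w (nset s x 0) n u" "n \<le> fst s y * B" "I (fst s y) u" "?F u"
      "in_field k u" by blast
  have "exec k (For x y c) s (0 + n) u"
    unfolding For_def using exec.Seq[OF exec.NSet[of k x "Num 0" s]] u(1) by simp
  then show ?thesis using u by (intro wpI) auto
qed

section \<open>Evaluation of binary forms\<close>

text \<open>
  For \<open>m > 0\<close>, this is the value at \<open>(x, y)\<close> of the form \<open>\<Sum>l<m. g l * x ^ l * y ^ (m - 1 - l)\<close> of degree
  \<open>m - 1\<close>. Multiplying by \<open>y\<close> in each round makes the powers of \<open>y\<close> come out without dividing by \<open>y\<close>.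
\<close>

primrec homog_eval :: "'a ring \<Rightarrow> 'a \<Rightarrow> 'a \<Rightarrow> (nat \<Rightarrow> 'a) \<Rightarrow> nat \<Rightarrow> 'a" where
  "homog_eval k x y g 0 = \<zero>\<^bsub>k\<^esub>"
| "homog_eval k x y g (Suc m) = homog_eval k x y g m \<otimes>\<^bsub>k\<^esub> y \<oplus>\<^bsub>k\<^esub> g m \<otimes>\<^bsub>k\<^esub> x [^]\<^bsub>k\<^esub> m"

text \<open>
  The form has its \<open>m\<close> coefficients in the array \<open>Z\<close> from address \<open>o\<close> on, and is evaluated at the
  point with index \<open>i\<close>. The cell \<open>xp\<close> holds the current power of the first coordinate.
\<close>

definition eval_prog :: "vname \<Rightarrow> vname \<Rightarrow> com" where
  "eval_prog Z R =
     Seq (FZero (R, Num 0)) (Seq (FOne (''xp'', Num 0))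
     (For ''j'' ''m''
       (Seq (FMul (R, Num 0) (R, Num 0) (''P1'', Var ''i''))
       (Seq (FMul (''tmp'', Num 0) (Z, NAdd (Var ''o'') (Var ''j'')) (''xp'', Num 0))
       (Seq (FAdd (R, Num 0) (R, Num 0) (''tmp'', Num 0))
            (FMul (''xp'', Num 0) (''xp'', Num 0) (''P0'', Var ''i'')))))))"

lemma nwr_eval [simp]: "nwr (eval_prog Z R) = {''j''}"
  and fwr_eval [simp]: "fwr (eval_prog Z R) = {R, ''xp'', ''tmp''}"
  by (auto simp: eval_prog_def)

lemma wp_eval:
  assumes k: "field k" and s: "in_field k s"
    and Z: "Z \<notin> {R, ''xp'', ''tmp''}" "R \<notin> {''xp'', ''tmp'', ''P0'', ''P1''}"
  shows "wp k (eval_prog Z R) s (\<lambda>n t. n \<le> fst s ''m'' * 4 \<and>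
     snd t R 0 = homog_eval k (snd s ''P0'' (fst s ''i'')) (snd s ''P1'' (fst s ''i''))
       (\<lambda>l. snd s Z (fst s ''o'' + l)) (fst s ''m''))"
proof -
  interpret field k by fact
  let ?x = "snd s ''P0'' (fst s ''i'')" and ?y = "snd s ''P1'' (fst s ''i'')"
  let ?g = "\<lambda>l. snd s Z (fst s ''o'' + l)"
  let ?s = "fset (fset s (R, Num 0) \<zero>\<^bsub>k\<^esub>) (''xp'', Num 0) \<one>\<^bsub>k\<^esub>"
  have s': "in_field k ?s" using s by (intro in_field_fset) auto
  let ?I = "\<lambda>j t. snd t R 0 = homog_eval k ?x ?y ?g j \<and> snd t ''xp'' 0 = ?x [^]\<^bsub>k\<^esub> j"
  let ?c = "Seq (FMul (R, Num 0) (R, Num 0) (''P1'', Var ''i''))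
       (Seq (FMul (''tmp'', Num 0) (Z, NAdd (Var ''o'') (Var ''j'')) (''xp'', Num 0))
       (Seq (FAdd (R, Num 0) (R, Num 0) (''tmp'', Num 0))
            (FMul (''xp'', Num 0) (''xp'', Num 0) (''P0'', Var ''i''))))"
  have "wp k (For ''j'' ''m'' ?c) ?s (\<lambda>n t. n \<le> fst ?s ''m'' * 4 \<and> ?I (fst ?s ''m'') t \<and>
     frame (insert ''j'' (nwr ?c)) (fwr ?c) ?s t \<and> in_field k t)"
  proof (rule wp_For[OF k s'])
    fix j t assume t: "j < fst ?s ''m''" "in_field k t"
      "frame (insert ''j'' (nwr ?c)) (fwr ?c) ?s t" "fst t ''j'' = j" "?I j t"
    show "wp k ?c t (\<lambda>n t'. n \<le> 4 \<and> ?I (Suc j) (nset t' ''j'' (Suc j)))"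
      using t Z by (auto simp: frame_def)
  qed (use Z in auto)
  then show ?thesis
    unfolding eval_prog_def by (auto elim: wp_mono)
qed

lemma wp_eval_frame:
  assumes k: "field k" and s: "in_field k s"
    and Z: "Z \<notin> {R, ''xp'', ''tmp''}" "R \<notin> {''xp'', ''tmp'', ''P0'', ''P1''}"
  shows "wp k (eval_prog Z R) s (\<lambda>n t. (n \<le> fst s ''m'' * 4 \<and>
     snd t R 0 = homog_eval k (snd s ''P0'' (fst s ''i'')) (snd s ''P1'' (fst s ''i''))
       (\<lambda>l. snd s Z (fst s ''o'' + l)) (fst s ''m'')) \<and>
     frame {''j''} {R, ''xp'', ''tmp''} s t \<and> in_field k t)"
  using wp_frame[OF k s wp_eval[OF k s Z]] by simp

section \<open>Elimination without division\<close>

text \<open>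
  Vectors are functions on all natural numbers, so that no dimension has to be carried around.
\<close>

definition linear_form :: "'a ring \<Rightarrow> ((nat \<Rightarrow> 'a) \<Rightarrow> 'a) \<Rightarrow> bool" where
  "linear_form k L \<longleftrightarrow> (\<forall>f a g b. range f \<subseteq> carrier k \<longrightarrow> range g \<subseteq> carrier k \<longrightarrow>
     a \<in> carrier k \<longrightarrow> b \<in> carrier k \<longrightarrow> L f \<in> carrier k \<and>
     L (\<lambda>l. a \<otimes>\<^bsub>k\<^esub> f l \<oplus>\<^bsub>k\<^esub> b \<otimes>\<^bsub>k\<^esub> g l) = a \<otimes>\<^bsub>k\<^esub> L f \<oplus>\<^bsub>k\<^esub> b \<otimes>\<^bsub>k\<^esub> L g)"

text \<open>
  Linear spans are generated inductively rather than by finite sums, so that elimination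
  is a plain induction over a combination.
\<close>

inductive_set lspan :: "'a ring \<Rightarrow> (nat \<Rightarrow> 'a) set \<Rightarrow> (nat \<Rightarrow> 'a) set"
  for k :: "'a ring" and G :: "(nat \<Rightarrow> 'a) set" where
  gen: "g \<in> G \<Longrightarrow> g \<in> lspan k G"
| zero: "(\<lambda>_. \<zero>\<^bsub>k\<^esub>) \<in> lspan k G"
| comb: "f \<in> lspan k G \<Longrightarrow> g \<in> lspan k G \<Longrightarrow> a \<in> carrier k \<Longrightarrow> b \<in> carrier k \<Longrightarrow>
         (\<lambda>l. a \<otimes>\<^bsub>k\<^esub> f l \<oplus>\<^bsub>k\<^esub> b \<otimes>\<^bsub>k\<^esub> g l) \<in> lspan k G"

lemma linear_formD:
  assumes "linear_form k L" "range f \<subseteq> carrier k"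
  shows "L f \<in> carrier k"
    and "range g \<subseteq> carrier k \<Longrightarrow> a \<in> carrier k \<Longrightarrow> b \<in> carrier k \<Longrightarrow>
     L (\<lambda>l. a \<otimes>\<^bsub>k\<^esub> f l \<oplus>\<^bsub>k\<^esub> b \<otimes>\<^bsub>k\<^esub> g l) = a \<otimes>\<^bsub>k\<^esub> L f \<oplus>\<^bsub>k\<^esub> b \<otimes>\<^bsub>k\<^esub> L g"
  using assms unfolding linear_form_def by blast+

lemma linear_form_diff:
  assumes k: "field k" and L: "linear_form k L" and fg: "range f \<subseteq> carrier k" "range g \<subseteq> carrier k"
    and ab: "a \<in> carrier k" "b \<in> carrier k"
  shows "L (\<lambda>l. a \<otimes>\<^bsub>k\<^esub> f l \<ominus>\<^bsub>k\<^esub> b \<otimes>\<^bsub>k\<^esub> g l) = a \<otimes>\<^bsub>k\<^esub> L f \<ominus>\<^bsub>k\<^esub> b \<otimes>\<^bsub>k\<^esub> L g"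
proof -
  interpret field k by fact
  have c: "\<And>l. f l \<in> carrier k" "\<And>l. g l \<in> carrier k" using fg by auto
  show ?thesis
    using linear_formD(2)[OF L fg(1) fg(2) ab(1) a_inv_closed[OF ab(2)]] c ab
      linear_formD(1)[OF L fg(1)] linear_formD(1)[OF L fg(2)]
    by (simp add: minus_eq l_minus)
qed

lemma lspan_carrier:
  assumes "field k" "\<forall>g\<in>G. range g \<subseteq> carrier k" "x \<in> lspan k G"
  shows "range x \<subseteq> carrier k"
proof -
  interpret field k by fact
  show ?thesis using assms(3,2) by induction (auto simp: image_subset_iff)
qed

context
  fixes k :: "'a ring" and L
  assumes k: "field k" and L: "linear_form k L"
begin

interpretation field k by (rule k)

lemma linear_form_zero: "L (\<lambda>_. \<zero>\<^bsub>k\<^esub>) = \<zero>\<^bsub>k\<^esub>"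
proof -
  have z: "range (\<lambda>_. \<zero>\<^bsub>k\<^esub>) \<subseteq> carrier k" by auto
  show ?thesis
    using linear_formD(2)[OF L z z, of "\<zero>\<^bsub>k\<^esub>" "\<zero>\<^bsub>k\<^esub>"] linear_formD(1)[OF L z] by simp
qed

text \<open>
  The map \<open>x \<mapsto> L p * x - L x * p\<close> is linear in \<open>x\<close>, hence maps combinations of the generators to
  combinations of their images.
\<close>

lemma lspan_eliminate_aux:
  assumes G: "\<forall>g\<in>G. range g \<subseteq> carrier k" and p: "range p \<subseteq> carrier k" and x: "x \<in> lspan k G"
  shows "(\<lambda>l. L p \<otimes>\<^bsub>k\<^esub> x l \<ominus>\<^bsub>k\<^esub> L x \<otimes>\<^bsub>k\<^esub> p l) \<in>
     lspan k ((\<lambda>g l. L p \<otimes>\<^bsub>k\<^esub> g l \<ominus>\<^bsub>k\<^esub> L g \<otimes>\<^bsub>k\<^esub> p l) ` G)" (is "_ \<in> lspan k ?H")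
  using x
proof induction
  case (gen g)
  then show ?case by (intro lspan.gen) auto
next
  case zero
  have "\<And>l. p l \<in> carrier k" using p by auto
  then have "(\<lambda>l. L p \<otimes>\<^bsub>k\<^esub> \<zero>\<^bsub>k\<^esub> \<ominus>\<^bsub>k\<^esub> L (\<lambda>_. \<zero>\<^bsub>k\<^esub>) \<otimes>\<^bsub>k\<^esub> p l) = (\<lambda>_. \<zero>\<^bsub>k\<^esub>)"
    using linear_formD(1)[OF L p] by (simp add: linear_form_zero minus_eq)
  then show ?case by (simp add: lspan.zero)
next
  case (comb f g a b)
  have fg: "range f \<subseteq> carrier k" "range g \<subseteq> carrier k"
    using comb lspan_carrier[OF k G] by auto
  have "(\<lambda>l. L p \<otimes>\<^bsub>k\<^esub> (a \<otimes>\<^bsub>k\<^esub> f l \<oplus>\<^bsub>k\<^esub> b \<otimes>\<^bsub>k\<^esub> g l) \<ominus>\<^bsub>k\<^esub>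
          L (\<lambda>l. a \<otimes>\<^bsub>k\<^esub> f l \<oplus>\<^bsub>k\<^esub> b \<otimes>\<^bsub>k\<^esub> g l) \<otimes>\<^bsub>k\<^esub> p l) =
        (\<lambda>l. a \<otimes>\<^bsub>k\<^esub> (L p \<otimes>\<^bsub>k\<^esub> f l \<ominus>\<^bsub>k\<^esub> L f \<otimes>\<^bsub>k\<^esub> p l) \<oplus>\<^bsub>k\<^esub>
             b \<otimes>\<^bsub>k\<^esub> (L p \<otimes>\<^bsub>k\<^esub> g l \<ominus>\<^bsub>k\<^esub> L g \<otimes>\<^bsub>k\<^esub> p l))"
  proof
    fix l
    have *: "f l \<in> carrier k" "g l \<in> carrier k" "p l \<in> carrier k" "L p \<in> carrier k"
      "L f \<in> carrier k" "L g \<in> carrier k"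
      using fg p linear_formD(1)[OF L] by auto
    show "L p \<otimes>\<^bsub>k\<^esub> (a \<otimes>\<^bsub>k\<^esub> f l \<oplus>\<^bsub>k\<^esub> b \<otimes>\<^bsub>k\<^esub> g l) \<ominus>\<^bsub>k\<^esub>
          L (\<lambda>l. a \<otimes>\<^bsub>k\<^esub> f l \<oplus>\<^bsub>k\<^esub> b \<otimes>\<^bsub>k\<^esub> g l) \<otimes>\<^bsub>k\<^esub> p l =
          a \<otimes>\<^bsub>k\<^esub> (L p \<otimes>\<^bsub>k\<^esub> f l \<ominus>\<^bsub>k\<^esub> L f \<otimes>\<^bsub>k\<^esub> p l) \<oplus>\<^bsub>k\<^esub>
             b \<otimes>\<^bsub>k\<^esub> (L p \<otimes>\<^bsub>k\<^esub> g l \<ominus>\<^bsub>k\<^esub> L g \<otimes>\<^bsub>k\<^esub> p l)"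
      unfolding linear_formD(2)[OF L fg(1) fg(2) comb(3,4)]
      using * comb(3,4) by algebra
  qed
  then show ?case using lspan.comb[OF comb.IH comb(3,4)] by simp
qed

text \<open>On the kernel of \<open>L\<close>, the map of the previous lemma is multiplication by the nonzero scalar \<open>L p\<close>.\<close>

lemma lspan_eliminate:
  assumes G: "\<forall>g\<in>G. range g \<subseteq> carrier k" and p: "range p \<subseteq> carrier k" and x: "x \<in> lspan k G"
    and Lp: "L p \<noteq> \<zero>\<^bsub>k\<^esub>" and Lx: "L x = \<zero>\<^bsub>k\<^esub>"
  shows "x \<in> lspan k ((\<lambda>g l. L p \<otimes>\<^bsub>k\<^esub> g l \<ominus>\<^bsub>k\<^esub> L g \<otimes>\<^bsub>k\<^esub> p l) ` G)" (is "_ \<in> lspan k ?H")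
proof -
  have pl: "\<And>l. p l \<in> carrier k" and xl: "\<And>l. x l \<in> carrier k"
    using p lspan_carrier[OF k G x] by auto
  have u: "L p \<in> Units k"
    using Lp linear_formD(1)[OF L p] field_Units by auto
  have u': "L p \<in> carrier k" "inv\<^bsub>k\<^esub> L p \<in> carrier k" using u by auto
  have "(\<lambda>l. inv\<^bsub>k\<^esub> L p \<otimes>\<^bsub>k\<^esub> (L p \<otimes>\<^bsub>k\<^esub> x l \<ominus>\<^bsub>k\<^esub> L x \<otimes>\<^bsub>k\<^esub> p l) \<oplus>\<^bsub>k\<^esub> \<zero>\<^bsub>k\<^esub> \<otimes>\<^bsub>k\<^esub> \<zero>\<^bsub>k\<^esub>) \<in> lspan k ?H"
    using lspan.comb[OF lspan_eliminate_aux[OF G p x] lspan.zero u'(2) zero_closed] .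
  moreover have "inv\<^bsub>k\<^esub> L p \<otimes>\<^bsub>k\<^esub> (L p \<otimes>\<^bsub>k\<^esub> x l \<ominus>\<^bsub>k\<^esub> L x \<otimes>\<^bsub>k\<^esub> p l) \<oplus>\<^bsub>k\<^esub> \<zero>\<^bsub>k\<^esub> \<otimes>\<^bsub>k\<^esub> \<zero>\<^bsub>k\<^esub> = x l" for l
    using u u' pl[of l] xl[of l] Lx by (simp add: minus_eq m_assoc[symmetric])
  ultimately show ?thesis by simp
qed

end

lemma lspan_trivial:
  assumes "field k" "\<forall>g\<in>G. g = (\<lambda>_. \<zero>\<^bsub>k\<^esub>)" "x \<in> lspan k G"
  shows "x = (\<lambda>_. \<zero>\<^bsub>k\<^esub>)"
proof -
  interpret field k by fact
  show ?thesis using assms(3,2) by induction auto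
qed

lemma lspan_unit_vectors:
  assumes k: "field k" and x: "range x \<subseteq> carrier k" "\<forall>l\<ge>n. x l = \<zero>\<^bsub>k\<^esub>"
  shows "x \<in> lspan k ((\<lambda>j l. if l = j then \<one>\<^bsub>k\<^esub> else \<zero>\<^bsub>k\<^esub>) ` {..<n})" (is "_ \<in> lspan k ?G")
proof -
  interpret field k by fact
  have xl: "\<And>l. x l \<in> carrier k" using x by auto
  have "(\<lambda>l. if l < i then x l else \<zero>\<^bsub>k\<^esub>) \<in> lspan k ?G" if "i \<le> n" for i
    using that
  proof (induction i)
    case 0
    then show ?case by (simp add: lspan.zero)
  next
    case (Suc i)
    have "(\<lambda>l. if l = i then \<one>\<^bsub>k\<^esub> else \<zero>\<^bsub>k\<^esub>) \<in> lspan k ?G"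
      using Suc.prems by (intro lspan.gen) auto
    from lspan.comb[OF Suc.IH this one_closed xl[of i]] Suc.prems
    have "(\<lambda>l. \<one>\<^bsub>k\<^esub> \<otimes>\<^bsub>k\<^esub> (if l < i then x l else \<zero>\<^bsub>k\<^esub>) \<oplus>\<^bsub>k\<^esub>
        x i \<otimes>\<^bsub>k\<^esub> (if l = i then \<one>\<^bsub>k\<^esub> else \<zero>\<^bsub>k\<^esub>)) \<in> lspan k ?G" by simp
    moreover have "(\<lambda>l. \<one>\<^bsub>k\<^esub> \<otimes>\<^bsub>k\<^esub> (if l < i then x l else \<zero>\<^bsub>k\<^esub>) \<oplus>\<^bsub>k\<^esub>
        x i \<otimes>\<^bsub>k\<^esub> (if l = i then \<one>\<^bsub>k\<^esub> else \<zero>\<^bsub>k\<^esub>)) = (\<lambda>l. if l < Suc i then x l else \<zero>\<^bsub>k\<^esub>)"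
      using xl by (auto simp: fun_eq_iff less_Suc_eq)
    ultimately show ?case by simp
  qed
  from this[of n] have "(\<lambda>l. if l < n then x l else \<zero>\<^bsub>k\<^esub>) \<in> lspan k ?G" by simp
  moreover have "(\<lambda>l. if l < n then x l else \<zero>\<^bsub>k\<^esub>) = x" using x by (auto simp: fun_eq_iff)
  ultimately show ?thesis by simp
qed

section \<open>A program for homogeneous systems\<close>

lemma homog_eval_closed:
  assumes "field k" "x \<in> carrier k" "y \<in> carrier k" "range g \<subseteq> carrier k"
  shows "homog_eval k x y g m \<in> carrier k"
proof -
  interpret field k by fact
  have "\<And>l. g l \<in> carrier k" using assms by auto
  then show ?thesis by (induction m) (use assms in auto)
qed

lemma homog_eval_linear:
  assumes k: "field k" and xy: "x \<in> carrier k" "y \<in> carrier k"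
    and fg: "range f \<subseteq> carrier k" "range g \<subseteq> carrier k" and ab: "a \<in> carrier k" "b \<in> carrier k"
  shows "homog_eval k x y (\<lambda>l. a \<otimes>\<^bsub>k\<^esub> f l \<oplus>\<^bsub>k\<^esub> b \<otimes>\<^bsub>k\<^esub> g l) m =
     a \<otimes>\<^bsub>k\<^esub> homog_eval k x y f m \<oplus>\<^bsub>k\<^esub> b \<otimes>\<^bsub>k\<^esub> homog_eval k x y g m"
proof -
  interpret field k by fact
  have c: "\<And>l. f l \<in> carrier k" "\<And>l. g l \<in> carrier k" using fg by auto
  note h = homog_eval_closed[OF k xy fg(1)] homog_eval_closed[OF k xy fg(2)]
  show ?thesis
  proof (induction m)
    case (Suc m)
    have "x [^]\<^bsub>k\<^esub> m \<in> carrier k" using xy by simp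
    then show ?case
      using Suc c[of m] h[of m] xy ab by (simp only: homog_eval.simps) algebra
  qed (use ab in simp)
qed

lemma homog_eval_cong: "(\<And>l. l < m \<Longrightarrow> f l = g l) \<Longrightarrow> homog_eval k x y f m = homog_eval k x y g m"
  by (induction m) auto

text \<open>
  The entries \<open>0, \<dots>, m - 1\<close> and \<open>m, \<dots>, 2 * m - 1\<close> of a vector are the coefficients of forms \<open>A\<close> and \<open>B\<close>, and
  the equation is \<open>A(x, y) * w = B(x, y) * u\<close>. It expresses that \<open>A / B\<close> has the value \<open>(u : w)\<close>.
\<close>

definition constraint :: "'a ring \<Rightarrow> 'a \<Rightarrow> 'a \<Rightarrow> 'a \<Rightarrow> 'a \<Rightarrow> nat \<Rightarrow> (nat \<Rightarrow> 'a) \<Rightarrow> 'a" where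
  "constraint k x y u w m g =
     homog_eval k x y g m \<otimes>\<^bsub>k\<^esub> w \<ominus>\<^bsub>k\<^esub> homog_eval k x y (\<lambda>l. g (m + l)) m \<otimes>\<^bsub>k\<^esub> u"

lemma linear_form_constraint:
  assumes k: "field k" and c: "x \<in> carrier k" "y \<in> carrier k" "u \<in> carrier k" "w \<in> carrier k"
  shows "linear_form k (constraint k x y u w m)"
  unfolding linear_form_def
proof (intro allI impI)
  interpret field k by fact
  fix f g :: "nat \<Rightarrow> 'a" and a b
  assume fg: "range f \<subseteq> carrier k" "range g \<subseteq> carrier k" and ab: "a \<in> carrier k" "b \<in> carrier k"
  have fg': "range (\<lambda>l. f (m + l)) \<subseteq> carrier k" "range (\<lambda>l. g (m + l)) \<subseteq> carrier k"
    using fg by auto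
  note h = homog_eval_closed[OF k c(1,2)]
  have ring: "(a \<otimes>\<^bsub>k\<^esub> p \<oplus>\<^bsub>k\<^esub> b \<otimes>\<^bsub>k\<^esub> q) \<otimes>\<^bsub>k\<^esub> w \<ominus>\<^bsub>k\<^esub> (a \<otimes>\<^bsub>k\<^esub> p' \<oplus>\<^bsub>k\<^esub> b \<otimes>\<^bsub>k\<^esub> q') \<otimes>\<^bsub>k\<^esub> u =
     a \<otimes>\<^bsub>k\<^esub> (p \<otimes>\<^bsub>k\<^esub> w \<ominus>\<^bsub>k\<^esub> p' \<otimes>\<^bsub>k\<^esub> u) \<oplus>\<^bsub>k\<^esub> b \<otimes>\<^bsub>k\<^esub> (q \<otimes>\<^bsub>k\<^esub> w \<ominus>\<^bsub>k\<^esub> q' \<otimes>\<^bsub>k\<^esub> u)"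
    if "p \<in> carrier k" "q \<in> carrier k" "p' \<in> carrier k" "q' \<in> carrier k" for p q p' q'
    using that c(3,4) ab by algebra
  show "constraint k x y u w m f \<in> carrier k \<and>
     constraint k x y u w m (\<lambda>l. a \<otimes>\<^bsub>k\<^esub> f l \<oplus>\<^bsub>k\<^esub> b \<otimes>\<^bsub>k\<^esub> g l) =
     a \<otimes>\<^bsub>k\<^esub> constraint k x y u w m f \<oplus>\<^bsub>k\<^esub> b \<otimes>\<^bsub>k\<^esub> constraint k x y u w m g"
    unfolding constraint_def homog_eval_linear[OF k c(1,2) fg ab] homog_eval_linear[OF k c(1,2) fg' ab]
    using h[OF fg(1), of m] h[OF fg(2), of m] h[OF fg'(1), of m] h[OF fg'(2), of m] c(3,4) ab
    by (simp add: ring)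
qed

lemma constraint_cong:
  assumes "\<And>l. l < 2 * m \<Longrightarrow> f l = g l"
  shows "constraint k x y u w m f = constraint k x y u w m g"
proof -
  have "homog_eval k x y f m = homog_eval k x y g m"
    using assms by (intro homog_eval_cong) simp
  moreover have "homog_eval k x y (\<lambda>l. f (m + l)) m = homog_eval k x y (\<lambda>l. g (m + l)) m"
    using assms by (intro homog_eval_cong) simp
  ultimately show ?thesis by (simp add: constraint_def)
qed

definition row :: "'a ring \<Rightarrow> vname \<Rightarrow> vname \<Rightarrow> 'a state \<Rightarrow> nat \<Rightarrow> (nat \<Rightarrow> 'a) \<Rightarrow> 'a" where
  "row k U W s i = constraint k (snd s ''P0'' i) (snd s ''P1'' i) (snd s U i) (snd s W i) (fst s ''m'')"

text \<open>
  The vectors are stored one after the other, each in \<open>n\<close> consecutive cells. They are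
  extended by zero, which elimination preserves, so that they obey its formulas as functions.
\<close>

definition basis :: "'a ring \<Rightarrow> vname \<Rightarrow> 'a state \<Rightarrow> nat \<Rightarrow> nat \<Rightarrow> 'a" where
  "basis k V s j = (\<lambda>l. if l < fst s ''n'' then snd s V (j * fst s ''n'' + l) else \<zero>\<^bsub>k\<^esub>)"

lemma basis_nset [simp]: "x \<noteq> ''n'' \<Longrightarrow> basis k V (nset s x v) = basis k V s"
  by (simp add: basis_def fun_eq_iff)

lemma linear_form_row: "field k \<Longrightarrow> in_field k s \<Longrightarrow> linear_form k (row k U W s i)"
  unfolding row_def by (intro linear_form_constraint) auto

lemma basis_carrier: "field k \<Longrightarrow> in_field k s \<Longrightarrow> range (basis k V s j) \<subseteq> carrier k"
proof -
  assume "field k" then interpret field k .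
  assume "in_field k s" then show ?thesis by (auto simp: basis_def)
qed

text \<open>The arrays with a fixed purpose in the program, which the array parameters must avoid.\<close>

definition work :: "vname set" where
  "work = {''r1'', ''r2'', ''xp'', ''tmp'', ''t1'', ''t2'', ''c'', ''pv'', ''cp'', ''zero'', ''P0'', ''P1''}"

lemma workD:
  assumes "V \<notin> work"
  shows "V \<noteq> ''r1''" "''r1'' \<noteq> V" "V \<noteq> ''r2''" "''r2'' \<noteq> V" "V \<noteq> ''xp''" "''xp'' \<noteq> V" "V \<noteq> ''tmp''" "''tmp'' \<noteq> V" "V \<noteq> ''t1''" "''t1'' \<noteq> V" "V \<noteq> ''t2''" "''t2'' \<noteq> V" "V \<noteq> ''c''" "''c'' \<noteq> V" "V \<noteq> ''pv''" "''pv'' \<noteq> V" "V \<noteq> ''cp''" "''cp'' \<noteq> V" "V \<noteq> ''zero''" "''zero'' \<noteq> V" "V \<noteq> ''P0''" "''P0'' \<noteq> V" "V \<noteq> ''P1''" "''P1'' \<noteq> V"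
  using assms by (auto simp: work_def)

text \<open>
  Stores in \<open>c\<close> the value of the current equation at the vector with index \<open>r\<close>. The variable \<open>p\<close> is the
  successor of the pivot index, and 0 stands for the absence of a pivot.
\<close>

definition value_prog :: "vname \<Rightarrow> vname \<Rightarrow> vname \<Rightarrow> com" where
  "value_prog V U W =
     Seq (NSet ''o'' (NMul (Var ''r'') (Var ''n'')))
    (Seq (eval_prog V ''r1'')
    (Seq (NSet ''o'' (NAdd (NMul (Var ''r'') (Var ''n'')) (Var ''m'')))
    (Seq (eval_prog V ''r2'')
    (Seq (FMul (''t1'', Num 0) (''r1'', Num 0) (W, Var ''i''))
    (Seq (FMul (''t2'', Num 0) (''r2'', Num 0) (U, Var ''i''))
    (Seq (FSub (''c'', Var ''r'') (''t1'', Num 0) (''t2'', Num 0))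
    (Seq (FEq ''z'' (''c'', Var ''r'') (''zero'', Num 0))
         (Cond (BLess (Var ''z'') (Num 1)) (NSet ''p'' (NAdd (Var ''r'') (Num 1))) Skip))))))))"

lemma nwr_value [simp]: "nwr (value_prog V U W) = {''j'', ''o'', ''z'', ''p''}"
  and fwr_value [simp]: "fwr (value_prog V U W) = {''r1'', ''r2'', ''xp'', ''tmp'', ''t1'', ''t2'', ''c''}"
  by (auto simp: value_prog_def)

lemma wp_value:
  assumes k: "field k" and s: "in_field k s"
    and A: "V \<notin> work" "U \<notin> work" "W \<notin> work"
    and z: "snd s ''zero'' 0 = \<zero>\<^bsub>k\<^esub>" and n: "fst s ''n'' = 2 * fst s ''m''"
  shows "wp k (value_prog V U W) s (\<lambda>n t. n \<le> fst s ''m'' * 8 + 4 \<and>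
     snd t ''c'' = (snd s ''c'')(fst s ''r'' := row k U W s (fst s ''i'') (basis k V s (fst s ''r''))) \<and>
     fst t ''p'' = (if row k U W s (fst s ''i'') (basis k V s (fst s ''r'')) = \<zero>\<^bsub>k\<^esub>
        then fst s ''p'' else Suc (fst s ''r'')))"
proof -
  let ?v = "row k U W s (fst s ''i'') (basis k V s (fst s ''r''))"
  let ?h = "\<lambda>o'. homog_eval k (snd s ''P0'' (fst s ''i'')) (snd s ''P1'' (fst s ''i''))
       (\<lambda>l. snd s V (o' + l)) (fst s ''m'')"
  have v: "?v = ?h (fst s ''r'' * fst s ''n'') \<otimes>\<^bsub>k\<^esub> snd s W (fst s ''i'') \<ominus>\<^bsub>k\<^esub>
     ?h (fst s ''r'' * fst s ''n'' + fst s ''m'') \<otimes>\<^bsub>k\<^esub> snd s U (fst s ''i'')"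
  proof -
    have "?v = constraint k (snd s ''P0'' (fst s ''i'')) (snd s ''P1'' (fst s ''i''))
       (snd s U (fst s ''i'')) (snd s W (fst s ''i'')) (fst s ''m'')
       (\<lambda>l. snd s V (fst s ''r'' * fst s ''n'' + l))"
      unfolding row_def by (rule constraint_cong) (simp add: basis_def n)
    then show ?thesis by (simp add: constraint_def add.assoc)
  qed
  have A': "V \<notin> {''r1'', ''xp'', ''tmp''}" "V \<notin> {''r2'', ''xp'', ''tmp''}"
    using A by (auto simp: work_def)
  show ?thesis
    unfolding value_prog_def wp_Seq wp_simps
    apply (rule wp_mono, rule wp_eval_frame[OF k])
    subgoal using s by simp
    subgoal using A' by simp
    subgoal by simp
    apply (elim conjE)
    apply (rule wp_mono, rule wp_eval_frame[OF k])
    subgoal by simp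
    subgoal using A' by simp
    subgoal by simp
    subgoal for n1 t1 n2 t2
      using A z unfolding v by (auto simp: frame_def work_def fun_eq_iff)
    done
qed

definition values_prog :: "vname \<Rightarrow> vname \<Rightarrow> vname \<Rightarrow> com" where
  "values_prog V U W = Seq (NSet ''p'' (Num 0)) (For ''r'' ''n'' (value_prog V U W))"

lemma nwr_values [simp]: "nwr (values_prog V U W) = {''j'', ''o'', ''z'', ''p'', ''r''}"
  and fwr_values [simp]: "fwr (values_prog V U W) = {''r1'', ''r2'', ''xp'', ''tmp'', ''t1'', ''t2'', ''c''}"
  by (auto simp: values_prog_def)

lemma wp_values:
  assumes k: "field k" and s: "in_field k s"
    and A: "V \<notin> work" "U \<notin> work" "W \<notin> work"
    and z: "snd s ''zero'' 0 = \<zero>\<^bsub>k\<^esub>" and n: "fst s ''n'' = 2 * fst s ''m''"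
  shows "wp k (values_prog V U W) s (\<lambda>n t. n \<le> fst s ''n'' * (fst s ''m'' * 8 + 4) \<and>
     (\<forall>j<fst s ''n''. snd t ''c'' j = row k U W s (fst s ''i'') (basis k V s j)) \<and>
     (fst t ''p'' = 0 \<longrightarrow> (\<forall>j<fst s ''n''. snd t ''c'' j = \<zero>\<^bsub>k\<^esub>)) \<and>
     (fst t ''p'' > 0 \<longrightarrow> fst t ''p'' - 1 < fst s ''n'' \<and> snd t ''c'' (fst t ''p'' - 1) \<noteq> \<zero>\<^bsub>k\<^esub>))"
proof -
  let ?s = "nset s ''p'' 0"
  let ?c = "value_prog V U W"
  let ?v = "\<lambda>j. row k U W s (fst s ''i'') (basis k V s j)"
  let ?I = "\<lambda>r t. (\<forall>j<r. snd t ''c'' j = ?v j) \<and>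
     (fst t ''p'' = 0 \<longrightarrow> (\<forall>j<r. ?v j = \<zero>\<^bsub>k\<^esub>)) \<and>
     (fst t ''p'' > 0 \<longrightarrow> fst t ''p'' - 1 < r \<and> ?v (fst t ''p'' - 1) \<noteq> \<zero>\<^bsub>k\<^esub>)"
  have "wp k (For ''r'' ''n'' ?c) ?s (\<lambda>n t. n \<le> fst ?s ''n'' * (fst s ''m'' * 8 + 4) \<and> ?I (fst ?s ''n'') t \<and>
     frame (insert ''r'' (nwr ?c)) (fwr ?c) ?s t \<and> in_field k t)"
  proof (rule wp_For[OF k, where I = ?I])
    show "in_field k ?s" using s by simp
    fix j t assume t: "j < fst ?s ''n''" "in_field k t"
      "frame (insert ''r'' (nwr ?c)) (fwr ?c) ?s t" "fst t ''r'' = j" "?I j t"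
    have same: "fst t ''i'' = fst s ''i''" "fst t ''m'' = fst s ''m''" "fst t ''n'' = fst s ''n''"
      "snd t V = snd s V" "snd t U = snd s U" "snd t W = snd s W" "snd t ''zero'' = snd s ''zero''"
      "snd t ''P0'' = snd s ''P0''" "snd t ''P1'' = snd s ''P1''"
      using t(3) A by (auto simp: frame_def work_def)
    have v: "row k U W t (fst t ''i'') (basis k V t (fst t ''r'')) = ?v j"
      using same t(4) by (simp add: row_def basis_def cong: if_cong)
    have "wp k ?c t (\<lambda>n t'. n \<le> fst t ''m'' * 8 + 4 \<and>
     snd t' ''c'' = (snd t ''c'')(fst t ''r'' := ?v j) \<and>
     fst t' ''p'' = (if ?v j = \<zero>\<^bsub>k\<^esub> then fst t ''p'' else Suc (fst t ''r'')))"
      using wp_value[OF k t(2) A] same z n unfolding v by simp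
    then show "wp k ?c t (\<lambda>n t'. n \<le> fst s ''m'' * 8 + 4 \<and> ?I (Suc j) (nset t' ''r'' (Suc j)))"
      by (rule wp_mono) (use t(4,5) same in \<open>auto simp: less_Suc_eq\<close>)
  qed auto
  then show ?thesis
    unfolding values_prog_def by (auto elim!: wp_mono)
qed

abbreviation entry :: "vname \<Rightarrow> cell" where
  "entry V \<equiv> (V, NAdd (NMul (Var ''r'') (Var ''n'')) (Var ''l''))"

abbreviation pivot :: nexp where
  "pivot \<equiv> NSub (Var ''p'') (Num 1)"

text \<open>
  The pivot vector and its value are copied first, as the update overwrites them: it treats the pivot
  vector like the others and turns it into zero.
\<close>

definition copy_prog :: "vname \<Rightarrow> com" where
  "copy_prog V = For ''l'' ''n'' (FCopy (''pv'', Var ''l'') (V, NAdd (NMul pivot (Var ''n'')) (Var ''l'')))"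

definition entry_prog :: "vname \<Rightarrow> com" where
  "entry_prog V =
    Seq (FMul (''t1'', Num 0) (''cp'', Num 0) (entry V))
   (Seq (FMul (''t2'', Num 0) (''c'', Var ''r'') (''pv'', Var ''l''))
        (FSub (entry V) (''t1'', Num 0) (''t2'', Num 0)))"

definition update_prog :: "vname \<Rightarrow> com" where
  "update_prog V =
     Seq (copy_prog V) (Seq (FCopy (''cp'', Num 0) (''c'', pivot))
         (For ''r'' ''n'' (For ''l'' ''n'' (entry_prog V))))"

lemma nwr_entry [simp]: "nwr (entry_prog V) = {}"
  and fwr_entry [simp]: "fwr (entry_prog V) = {V, ''t1'', ''t2''}"
  by (auto simp: entry_prog_def)

lemma nwr_copy [simp]: "nwr (copy_prog V) = {''l''}"
  and fwr_copy [simp]: "fwr (copy_prog V) = {''pv''}"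
  by (auto simp: copy_prog_def)

lemma nwr_update [simp]: "nwr (update_prog V) = {''l'', ''r''}"
  and fwr_update [simp]: "fwr (update_prog V) = {V, ''pv'', ''cp'', ''t1'', ''t2''}"
  by (auto simp: update_prog_def)

lemma wp_copy:
  assumes k: "field k" and s: "in_field k s" and A: "V \<notin> work"
  shows "wp k (copy_prog V) s (\<lambda>n t. n = 0 \<and>
     (\<forall>l<fst s ''n''. snd t ''pv'' l = snd s V ((fst s ''p'' - 1) * fst s ''n'' + l)) \<and>
     frame {''l''} {''pv''} s t \<and> in_field k t)"
proof -
  let ?c = "FCopy (''pv'', Var ''l'') (V, NAdd (NMul pivot (Var ''n'')) (Var ''l''))"
  let ?I = "\<lambda>l t. \<forall>l'<l. snd t ''pv'' l' = snd s V ((fst s ''p'' - 1) * fst s ''n'' + l')"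
  have "wp k (For ''l'' ''n'' ?c) s (\<lambda>n t. n \<le> fst s ''n'' * 0 \<and> ?I (fst s ''n'') t \<and>
     frame (insert ''l'' (nwr ?c)) (fwr ?c) s t \<and> in_field k t)"
  proof (rule wp_For[OF k s, where I = ?I])
    fix j t assume "frame (insert ''l'' (nwr ?c)) (fwr ?c) s t" "fst t ''l'' = j" "?I j t"
    then show "wp k ?c t (\<lambda>n t'. n \<le> 0 \<and> ?I (Suc j) (nset t' ''l'' (Suc j)))"
      using A by (auto simp: frame_def work_def less_Suc_eq)
  qed auto
  then show ?thesis
    unfolding copy_prog_def by (auto elim!: wp_mono)
qed

lemma address_eq_iff:
  fixes n :: nat
  assumes "l < n" "l' < n"
  shows "j * n + l = j' * n + l' \<longleftrightarrow> j = j' \<and> l = l'"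
proof
  assume e: "j * n + l = j' * n + l'"
  have "(j * n + l) div n = j" "(j' * n + l') div n = j'" using assms by auto
  with e have "j = j'" by simp
  with e show "j = j' \<and> l = l'" by simp
qed simp

lemma wp_update:
  assumes k: "field k" and s: "in_field k s" and A: "V \<notin> work"
    and p: "fst s ''p'' > 0" "fst s ''p'' - 1 < fst s ''n''"
  shows "wp k (update_prog V) s (\<lambda>n t. n \<le> fst s ''n'' * (fst s ''n'' * 3) \<and>
     (\<forall>j<fst s ''n''. basis k V t j = (\<lambda>l. snd s ''c'' (fst s ''p'' - 1) \<otimes>\<^bsub>k\<^esub> basis k V s j l \<ominus>\<^bsub>k\<^esub>
        snd s ''c'' j \<otimes>\<^bsub>k\<^esub> basis k V s (fst s ''p'' - 1) l)))"
proof -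
  interpret field k by fact
  let ?n = "fst s ''n''"
  let ?v = "\<lambda>j l. snd s ''c'' (fst s ''p'' - 1) \<otimes>\<^bsub>k\<^esub> snd s V (j * ?n + l) \<ominus>\<^bsub>k\<^esub>
        snd s ''c'' j \<otimes>\<^bsub>k\<^esub> snd s V ((fst s ''p'' - 1) * ?n + l)"
  let ?in = "entry_prog V"
  let ?mid = "For ''l'' ''n'' ?in"
  let ?w = "\<lambda>Q j l. if Q then ?v j l else snd s V (j * ?n + l)"
  let ?base = "\<lambda>t. (\<forall>l<?n. snd t ''pv'' l = snd s V ((fst s ''p'' - 1) * ?n + l)) \<and>
      snd t ''cp'' 0 = snd s ''c'' (fst s ''p'' - 1) \<and> snd t ''c'' = snd s ''c'' \<and> fst t ''n'' = ?n"
  let ?I = "\<lambda>r t. \<forall>j<?n. \<forall>l<?n. snd t V (j * ?n + l) = ?w (j < r) j l"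
  let ?J = "\<lambda>r l' t. \<forall>j<?n. \<forall>l<?n. snd t V (j * ?n + l) = ?w (j < r \<or> j = r \<and> l < l') j l"
  have inner: "wp k ?mid t (\<lambda>n t'. n \<le> ?n * 3 \<and> ?J r ?n t')"
    if t: "in_field k t" "?base t" "?J r 0 t" "fst t ''r'' = r" "r < ?n" for t r
  proof -
    have "wp k ?mid t (\<lambda>n t'. n \<le> fst t ''n'' * 3 \<and> ?J r (fst t ''n'') t' \<and>
       frame (insert ''l'' (nwr ?in)) (fwr ?in) t t' \<and> in_field k t')"
    proof (rule wp_For[OF k t(1), where I = "?J r"])
      show "?J r 0 (nset t ''l'' 0)" using t by simp
      fix l u assume u: "l < fst t ''n''" "in_field k u" "frame (insert ''l'' (nwr ?in)) (fwr ?in) t u"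
         "fst u ''l'' = l" "?J r l u"
      have same: "snd u ''pv'' l = snd s V ((fst s ''p'' - 1) * ?n + l)"
        "snd u ''cp'' 0 = snd s ''c'' (fst s ''p'' - 1)" "snd u ''c'' = snd s ''c''" "fst u ''n'' = ?n"
        "fst u ''r'' = r" "l < ?n"
        using u(1,3) A t by (auto simp: frame_def work_def)
      have Vl: "snd u V (r * ?n + l) = snd s V (r * ?n + l)"
        using u(5) t(5) same(6) by simp
      show "wp k ?in u (\<lambda>n t'. n \<le> 3 \<and> ?J r (Suc l) (nset t' ''l'' (Suc l)))"
        unfolding entry_prog_def
        using A same u(4,5) Vl t(5) by (auto simp: work_def address_eq_iff less_Suc_eq)
    qed auto
    then show ?thesis using t by (auto elim!: wp_mono)
  qed
  have outer: "wp k (For ''r'' ''n'' ?mid) t (\<lambda>n t'. n \<le> ?n * (?n * 3) \<and> ?I ?n t' \<and> fst t' ''n'' = ?n)"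
    if t: "in_field k t" "?base t" "?I 0 t" for t
  proof -
    have "wp k (For ''r'' ''n'' ?mid) t (\<lambda>n t'. n \<le> fst t ''n'' * (?n * 3) \<and> ?I (fst t ''n'') t' \<and>
       frame (insert ''r'' (nwr ?mid)) (fwr ?mid) t t' \<and> in_field k t')"
    proof (rule wp_For[OF k t(1), where I = ?I])
      fix r u assume u: "r < fst t ''n''" "in_field k u" "frame (insert ''r'' (nwr ?mid)) (fwr ?mid) t u"
         "fst u ''r'' = r" "?I r u"
      have "''pv'' \<noteq> V" "''cp'' \<noteq> V" "''c'' \<noteq> V"
        using A by (auto simp: work_def)
      then have "snd u ''pv'' = snd t ''pv''" "snd u ''cp'' = snd t ''cp''" "snd u ''c'' = snd t ''c''"
        "fst u ''n'' = fst t ''n''"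
        using u(3) by (simp_all add: frame_def)
      then have b: "?base u" using t(2) by simp
      have J: "?J r 0 u" using u(5) by simp
      have "r < ?n" using u(1) t(2) by simp
      from inner[OF u(2) b J u(4) this]
      show "wp k ?mid u (\<lambda>n t'. n \<le> ?n * 3 \<and> ?I (Suc r) (nset t' ''r'' (Suc r)))"
        by (rule wp_mono) (simp add: less_Suc_eq)
    qed (use t in auto)
    then show ?thesis using t by (auto elim!: wp_mono simp: frame_def)
  qed
  show ?thesis
    unfolding update_prog_def wp_Seq wp_simps
    apply (rule wp_mono, rule wp_copy[OF k s A])
    apply (rule wp_mono, rule outer)
    subgoal by (intro in_field_fset) (auto)
    subgoal using A by (auto simp: frame_def work_def)
    subgoal using A by (auto simp: frame_def work_def)
    subgoal using p(2) in_fieldD[OF s] by (auto simp: basis_def fun_eq_iff minus_eq)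
    done
qed

text \<open>The unit vectors. The array must be zero before, so that only the diagonal has to be written.\<close>

definition init_prog :: "vname \<Rightarrow> com" where
  "init_prog V = For ''r'' ''n'' (FOne (V, NAdd (NMul (Var ''r'') (Var ''n'')) (Var ''r'')))"

definition search_prog :: "vname \<Rightarrow> com" where
  "search_prog V = For ''r'' ''n'' (For ''l'' ''n''
     (Seq (FEq ''z'' (entry V) (''zero'', Num 0))
          (Cond (BLess (Var ''z'') (Num 1)) (NSet ''q'' (Var ''r'')) Skip)))"

lemma nwr_init [simp]: "nwr (init_prog V) = {''r''}"
  and fwr_init [simp]: "fwr (init_prog V) = {V}"
  by (auto simp: init_prog_def)

lemma nwr_search [simp]: "nwr (search_prog V) = {''r'', ''l'', ''z'', ''q''}"
  and fwr_search [simp]: "fwr (search_prog V) = {}"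
  by (auto simp: search_prog_def)

lemma wp_init:
  assumes k: "field k" and s: "in_field k s" and V: "snd s V = (\<lambda>_. \<zero>\<^bsub>k\<^esub>)"
  shows "wp k (init_prog V) s (\<lambda>n t. n = 0 \<and>
     (\<forall>j<fst s ''n''. basis k V t j = (\<lambda>l. if l = j then \<one>\<^bsub>k\<^esub> else \<zero>\<^bsub>k\<^esub>)))"
proof -
  let ?n = "fst s ''n''"
  let ?c = "FOne (V, NAdd (NMul (Var ''r'') (Var ''n'')) (Var ''r''))"
  let ?I = "\<lambda>r t. \<forall>j<?n. \<forall>l<?n. snd t V (j * ?n + l) = (if j < r \<and> l = j then \<one>\<^bsub>k\<^esub> else \<zero>\<^bsub>k\<^esub>)"
  have "wp k (For ''r'' ''n'' ?c) s (\<lambda>n t. n \<le> fst s ''n'' * 0 \<and> ?I (fst s ''n'') t \<and>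
     frame (insert ''r'' (nwr ?c)) (fwr ?c) s t \<and> in_field k t)"
  proof (rule wp_For[OF k s, where I = ?I])
    fix r t assume "r < ?n" "frame (insert ''r'' (nwr ?c)) (fwr ?c) s t" "fst t ''r'' = r" "?I r t"
    then show "wp k ?c t (\<lambda>n t'. n \<le> 0 \<and> ?I (Suc r) (nset t' ''r'' (Suc r)))"
      by (auto simp: frame_def less_Suc_eq address_eq_iff)
  qed (auto simp: V)
  then show ?thesis
    unfolding init_prog_def by (auto elim!: wp_mono simp: basis_def frame_def fun_eq_iff)
qed

lemma wp_search:
  assumes k: "field k" and s: "in_field k s" and z: "snd s ''zero'' 0 = \<zero>\<^bsub>k\<^esub>"
    and V: "\<exists>j<fst s ''n''. basis k V s j \<noteq> (\<lambda>_. \<zero>\<^bsub>k\<^esub>)"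
  shows "wp k (search_prog V) s (\<lambda>n t. n \<le> fst s ''n'' * (fst s ''n'' * 1) \<and>
     fst t ''q'' < fst s ''n'' \<and> basis k V s (fst t ''q'') \<noteq> (\<lambda>_. \<zero>\<^bsub>k\<^esub>))"
proof -
  let ?n = "fst s ''n''"
  let ?nz = "\<lambda>j. \<exists>l<?n. snd s V (j * ?n + l) \<noteq> \<zero>\<^bsub>k\<^esub>"
  have nz: "basis k V s j \<noteq> (\<lambda>_. \<zero>\<^bsub>k\<^esub>) \<longleftrightarrow> ?nz j" for j
    by (auto simp: basis_def fun_eq_iff)
  let ?in = "Seq (FEq ''z'' (entry V) (''zero'', Num 0))
          (Cond (BLess (Var ''z'') (Num 1)) (NSet ''q'' (Var ''r'')) Skip)"
  let ?mid = "For ''l'' ''n'' ?in"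
  let ?ok = "\<lambda>t. fst t ''q'' < ?n \<and> ?nz (fst t ''q'')"
  let ?I = "\<lambda>r t. (\<exists>j<r. ?nz j) \<longrightarrow> ?ok t"
  let ?J = "\<lambda>r l t. (\<exists>j<r. ?nz j) \<or> (\<exists>l'<l. snd s V (r * ?n + l') \<noteq> \<zero>\<^bsub>k\<^esub>) \<longrightarrow> ?ok t"
  have inner: "wp k ?mid t (\<lambda>n t'. n \<le> ?n * 1 \<and> ?J r ?n t')"
    if t: "in_field k t" "snd t = snd s" "fst t ''n'' = ?n" "?J r 0 t" "fst t ''r'' = r" "r < ?n" for t r
  proof -
    have "wp k ?mid t (\<lambda>n t'. n \<le> fst t ''n'' * 1 \<and> ?J r (fst t ''n'') t' \<and>
       frame (insert ''l'' (nwr ?in)) (fwr ?in) t t' \<and> in_field k t')"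
    proof (rule wp_For[OF k t(1), where I = "?J r"])
      show "?J r 0 (nset t ''l'' 0)" using t by simp
      fix l u assume u: "l < fst t ''n''" "frame (insert ''l'' (nwr ?in)) (fwr ?in) t u"
         "fst u ''l'' = l" "?J r l u"
      show "wp k ?in u (\<lambda>n t'. n \<le> 1 \<and> ?J r (Suc l) (nset t' ''l'' (Suc l)))"
      proof -
        have same: "snd u = snd s" "fst u ''n'' = ?n" "fst u ''r'' = r"
          using u(2) t(2,3,5) by (auto simp: frame_def)
        have lr: "l < ?n" "r < ?n" using u(1) t(3,6) by auto
        show ?thesis
        proof (cases "snd s V (r * ?n + l) = \<zero>\<^bsub>k\<^esub>")
          case True
          then show ?thesis
            using same z u(3,4) by (simp add: less_Suc_eq) metis
        next
          case False
          then show ?thesis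
            using same z u(3) lr by auto
        qed
      qed
    qed auto
    then show ?thesis using t by (auto elim!: wp_mono)
  qed
  have "wp k (For ''r'' ''n'' ?mid) s (\<lambda>n t'. n \<le> fst s ''n'' * (?n * 1) \<and> ?I (fst s ''n'') t' \<and>
     frame (insert ''r'' (nwr ?mid)) (fwr ?mid) s t' \<and> in_field k t')"
  proof (rule wp_For[OF k s, where I = ?I])
    fix r u assume u: "r < fst s ''n''" "in_field k u" "frame (insert ''r'' (nwr ?mid)) (fwr ?mid) s u"
       "fst u ''r'' = r" "?I r u"
    have "snd u = snd s" "fst u ''n'' = ?n" using u(3) by (auto simp: frame_def)
    from inner[OF u(2) this _ u(4) u(1)] u(5)
    have "wp k ?mid u (\<lambda>n t'. n \<le> ?n * 1 \<and> ?J r ?n t')" by simp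
    then show "wp k ?mid u (\<lambda>n t'. n \<le> ?n * 1 \<and> ?I (Suc r) (nset t' ''r'' (Suc r)))"
      by (rule wp_mono) (auto simp: less_Suc_eq)
  qed auto
  then show ?thesis
    unfolding search_prog_def by (rule wp_mono) (use V nz in auto)
qed

definition step_prog :: "vname \<Rightarrow> vname \<Rightarrow> vname \<Rightarrow> com" where
  "step_prog V U W =
     Seq (values_prog V U W) (Cond (BLess (Num 0) (Var ''p'')) (update_prog V) Skip)"

lemma nwr_step [simp]: "nwr (step_prog V U W) = {''j'', ''o'', ''z'', ''p'', ''r'', ''l''}"
  and fwr_step [simp]: "fwr (step_prog V U W) =
    {V, ''r1'', ''r2'', ''xp'', ''tmp'', ''t1'', ''t2'', ''c'', ''pv'', ''cp''}"
  by (auto simp: step_prog_def)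

text \<open>
  The new vectors are combinations of the old ones, so any linear form \<open>L\<close> that vanishes on the old
  family vanishes on the new one. This keeps the equations treated before satisfied.
\<close>

lemma wp_step:
  assumes k: "field k" and s: "in_field k s"
    and A: "V \<notin> work" "U \<notin> work" "W \<notin> work"
    and z: "snd s ''zero'' 0 = \<zero>\<^bsub>k\<^esub>" and n: "fst s ''n'' = 2 * fst s ''m''"
    and x: "x \<in> lspan k (basis k V s ` {..<fst s ''n''})"
      "row k U W s (fst s ''i'') x = \<zero>\<^bsub>k\<^esub>"
  shows "wp k (step_prog V U W) s (\<lambda>n t.
     n \<le> fst s ''n'' * (fst s ''m'' * 8 + 4) + fst s ''n'' * (fst s ''n'' * 3) \<and>
     x \<in> lspan k (basis k V t ` {..<fst s ''n''}) \<and>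
     (\<forall>j<fst s ''n''. row k U W s (fst s ''i'') (basis k V t j) = \<zero>\<^bsub>k\<^esub> \<and>
        (\<forall>L. linear_form k L \<longrightarrow> (\<forall>j<fst s ''n''. L (basis k V s j) = \<zero>\<^bsub>k\<^esub>) \<longrightarrow>
             L (basis k V t j) = \<zero>\<^bsub>k\<^esub>)))"
    (is "wp _ _ _ (\<lambda>n t. n \<le> ?b1 + ?b2 \<and> ?Q t)")
proof -
  interpret field k by fact
  let ?n = "fst s ''n''" and ?L = "row k U W s (fst s ''i'')" and ?B = "basis k V s"
  have L: "linear_form k ?L" by (rule linear_form_row[OF k s])
  have B: "range (?B j) \<subseteq> carrier k" for j by (rule basis_carrier[OF k s])
  have "wp k (values_prog V U W) s (\<lambda>n1 t. wp k (Cond (BLess (Num 0) (Var ''p'')) (update_prog V) Skip) t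
      (\<lambda>n2 u. n1 + n2 \<le> ?b1 + ?b2 \<and> ?Q u))"
  proof (rule wp_mono[OF wp_frame[OF k s wp_values[OF k s A z n]]], elim conjE)
    fix n1 t
    assume n1: "n1 \<le> ?b1" and c: "\<forall>j<?n. snd t ''c'' j = ?L (?B j)"
      and p0: "fst t ''p'' = 0 \<longrightarrow> (\<forall>j<?n. snd t ''c'' j = \<zero>\<^bsub>k\<^esub>)"
      and p1: "fst t ''p'' > 0 \<longrightarrow> fst t ''p'' - 1 < ?n \<and> snd t ''c'' (fst t ''p'' - 1) \<noteq> \<zero>\<^bsub>k\<^esub>"
      and F: "frame (nwr (values_prog V U W)) (fwr (values_prog V U W)) s t" and t: "in_field k t"
    have same: "fst t ''n'' = ?n" "snd t V = snd s V"
      using F A by (auto simp: frame_def work_def)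
    have Bt: "basis k V t j = ?B j" for j
      using same by (simp add: basis_def cong: if_cong)
    show "wp k (Cond (BLess (Num 0) (Var ''p'')) (update_prog V) Skip) t
      (\<lambda>n2 u. n1 + n2 \<le> ?b1 + ?b2 \<and> ?Q u)"
    proof (cases "fst t ''p'' = 0")
      case True
      then show ?thesis using n1 c p0 Bt x(1) by simp
    next
      case False
      let ?p = "fst t ''p'' - 1"
      have p: "fst t ''p'' > 0" "?p < ?n" "?p < fst t ''n''" "?L (?B ?p) \<noteq> \<zero>\<^bsub>k\<^esub>"
        using False p1 c same by auto
      have "wp k (update_prog V) t (\<lambda>n2 u. n1 + n2 \<le> ?b1 + ?b2 \<and> ?Q u)"
      proof (rule wp_mono[OF wp_update[OF k t A(1) p(1,3)]], elim conjE)
        fix n2 u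
        assume n2: "n2 \<le> fst t ''n'' * (fst t ''n'' * 3)"
          and u: "\<forall>j<fst t ''n''. basis k V u j = (\<lambda>l. snd t ''c'' ?p \<otimes>\<^bsub>k\<^esub> basis k V t j l
              \<ominus>\<^bsub>k\<^esub> snd t ''c'' j \<otimes>\<^bsub>k\<^esub> basis k V t ?p l)"
        have u': "basis k V u j = (\<lambda>l. ?L (?B ?p) \<otimes>\<^bsub>k\<^esub> ?B j l \<ominus>\<^bsub>k\<^esub> ?L (?B j) \<otimes>\<^bsub>k\<^esub> ?B ?p l)"
          if "j < ?n" for j
          using u c p(2) that same(1) unfolding Bt by simp
        have im: "(\<lambda>g l. ?L (?B ?p) \<otimes>\<^bsub>k\<^esub> g l \<ominus>\<^bsub>k\<^esub> ?L g \<otimes>\<^bsub>k\<^esub> ?B ?p l) ` (?B ` {..<?n}) =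
            basis k V u ` {..<?n}"
          unfolding image_image using u' by (intro image_cong) auto
        have xu: "x \<in> lspan k (basis k V u ` {..<?n})"
          using lspan_eliminate[OF k L _ B x(1) p(4) x(2)] B unfolding im by auto
        have e: "L' (basis k V u j) = ?L (?B ?p) \<otimes>\<^bsub>k\<^esub> L' (?B j) \<ominus>\<^bsub>k\<^esub> ?L (?B j) \<otimes>\<^bsub>k\<^esub> L' (?B ?p)"
          if "linear_form k L'" "j < ?n" for L' j
          unfolding u'[OF that(2)]
          using linear_form_diff[OF k that(1) B B linear_formD(1)[OF L B] linear_formD(1)[OF L B]] .
        have "?L (basis k V u j) = \<zero>\<^bsub>k\<^esub>" if "j < ?n" for j
          unfolding e[OF L that] using linear_formD(1)[OF L B] by (simp add: minus_eq r_neg m_comm)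
        moreover have "L' (basis k V u j) = \<zero>\<^bsub>k\<^esub>"
          if "linear_form k L'" "\<forall>j<?n. L' (?B j) = \<zero>\<^bsub>k\<^esub>" "j < ?n" for L' j
          unfolding e[OF that(1,3)] using that(2,3) p(2) linear_formD(1)[OF L B] by (simp add: minus_eq)
        moreover have "n1 + n2 \<le> ?b1 + ?b2"
          using n1 n2 same(1) by simp
        ultimately show "n1 + n2 \<le> ?b1 + ?b2 \<and> ?Q u"
          using xu by blast
      qed
      then show ?thesis using p(1) by simp
    qed
  qed
  then show ?thesis by (simp add: step_prog_def)
qed

definition solves ::
  "'a ring \<Rightarrow> nat \<Rightarrow> (nat \<Rightarrow> 'a) \<Rightarrow> (nat \<Rightarrow> 'a) \<Rightarrow> (nat \<Rightarrow> 'a) \<Rightarrow> (nat \<Rightarrow> 'a) \<Rightarrow> nat \<Rightarrow> (nat \<Rightarrow> 'a) \<Rightarrow> bool" where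
  "solves k N x y u w m g \<longleftrightarrow> range g \<subseteq> carrier k \<and> (\<exists>l<2 * m. g l \<noteq> \<zero>\<^bsub>k\<^esub>) \<and>
     (\<forall>i<N. constraint k (x i) (y i) (u i) (w i) m g = \<zero>\<^bsub>k\<^esub>)"

definition solve_prog :: "vname \<Rightarrow> vname \<Rightarrow> vname \<Rightarrow> com" where
  "solve_prog V U W =
     Seq (NSet ''n'' (NMul (Num 2) (Var ''m'')))
    (Seq (init_prog V)
    (Seq (For ''i'' ''N'' (step_prog V U W))
         (search_prog V)))"

lemma nwr_solve [simp]: "nwr (solve_prog V U W) =
    {''n'', ''i'', ''j'', ''o'', ''z'', ''p'', ''r'', ''l'', ''q''}"
  and fwr_solve [simp]: "fwr (solve_prog V U W) =
    {V, ''r1'', ''r2'', ''xp'', ''tmp'', ''t1'', ''t2'', ''c'', ''pv'', ''cp''}"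
  by (auto simp: solve_prog_def)

text \<open>
  The invariant keeps one nonzero solution \<open>x\<close> in the span of the family. As the span of a family of zero
  vectors is zero, the search at the end succeeds.
\<close>

lemma wp_solve:
  assumes k: "field k" and s: "in_field k s"
    and A: "V \<notin> work" "U \<notin> work" "W \<notin> work" "U \<noteq> V" "W \<noteq> V"
    and z: "snd s ''zero'' 0 = \<zero>\<^bsub>k\<^esub>" and V: "snd s V = (\<lambda>_. \<zero>\<^bsub>k\<^esub>)"
    and N: "N = fst s ''N''" and m: "m = fst s ''m''"
    and sol: "solves k N (snd s ''P0'') (snd s ''P1'') (snd s U) (snd s W) m g"
  shows "wp k (solve_prog V U W) s (\<lambda>n t.
     n \<le> N * (2 * m * (m * 8 + 4) + 2 * m * (2 * m * 3)) + 2 * m * (2 * m) \<and> fst t ''n'' = 2 * m \<and>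
     solves k N (snd s ''P0'') (snd s ''P1'') (snd s U) (snd s W) m
       (\<lambda>l. snd t V (fst t ''q'' * fst t ''n'' + l)))"
proof -
  interpret field k by fact
  let ?n = "2 * m"
  let ?s = "nset s ''n'' ?n"
  let ?row = "row k U W s"
  define x where "x = (\<lambda>l. if l < ?n then g l else \<zero>\<^bsub>k\<^esub>)"
  have x: "range x \<subseteq> carrier k" "x \<noteq> (\<lambda>_. \<zero>\<^bsub>k\<^esub>)" "\<forall>l\<ge>?n. x l = \<zero>\<^bsub>k\<^esub>"
    using sol by (auto simp: solves_def x_def fun_eq_iff)
  have rx: "?row i x = \<zero>\<^bsub>k\<^esub>" if "i < N" for i
  proof -
    have "?row i x = ?row i g"
      unfolding row_def by (rule constraint_cong) (simp add: x_def m)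
    then show ?thesis using sol that by (simp add: row_def solves_def m)
  qed
  have s': "in_field k ?s" using s by simp
  let ?c = "step_prog V U W"
  let ?b = "?n * (m * 8 + 4) + ?n * (?n * 3)"
  let ?I = "\<lambda>i t. x \<in> lspan k (basis k V t ` {..<?n}) \<and>
     (\<forall>i'<i. \<forall>j<?n. ?row i' (basis k V t j) = \<zero>\<^bsub>k\<^esub>)"
  have loop: "wp k (For ''i'' ''N'' ?c) t (\<lambda>n u. n \<le> fst t ''N'' * ?b \<and> ?I (fst t ''N'') u \<and>
     frame (insert ''i'' (nwr ?c)) (fwr ?c) t u \<and> in_field k u)"
    if t: "in_field k t" "frame (insert ''n'' (nwr (init_prog V))) (fwr (init_prog V)) s t"
      "fst t ''n'' = ?n" "x \<in> lspan k (basis k V t ` {..<?n})" for t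
  proof (rule wp_For[OF k t(1), where I = ?I])
    show "?I 0 (nset t ''i'' 0)" using t(4) by simp
    fix i u assume u: "i < fst t ''N''" "in_field k u" "frame (insert ''i'' (nwr ?c)) (fwr ?c) t u"
      "fst u ''i'' = i" "?I i u"
    have same: "snd u U = snd s U" "snd u W = snd s W" "snd u ''P0'' = snd s ''P0''"
      "snd u ''P1'' = snd s ''P1''" "snd u ''zero'' = snd s ''zero''" "fst u ''n'' = ?n"
      "fst u ''m'' = m" "fst t ''N'' = N"
      using frameD[OF u(3)] frameD[OF t(2)] t(3) A(4,5) m N
      by (simp_all add: workD[OF A(1)] workD[OF A(2)] workD[OF A(3)])
    have r: "row k U W u i' = ?row i'" for i'
      using same m by (simp add: row_def)
    have "wp k ?c u (\<lambda>n v. n \<le> ?b \<and> x \<in> lspan k (basis k V v ` {..<?n}) \<and>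
       (\<forall>j<?n. ?row i (basis k V v j) = \<zero>\<^bsub>k\<^esub> \<and>
          (\<forall>L. linear_form k L \<longrightarrow> (\<forall>j<?n. L (basis k V u j) = \<zero>\<^bsub>k\<^esub>) \<longrightarrow> L (basis k V v j) = \<zero>\<^bsub>k\<^esub>)))"
      using wp_step[OF k u(2) A(1,2,3), of x] same r u(4,5) z rx[of i] u(1) by simp
    then show "wp k ?c u (\<lambda>n v. n \<le> ?b \<and> ?I (Suc i) (nset v ''i'' (Suc i)))"
    proof (rule wp_mono, elim conjE)
      fix n v
      assume nb: "n \<le> ?b" and xv: "x \<in> lspan k (basis k V v ` {..<?n})"
        and r: "\<forall>j<?n. ?row i (basis k V v j) = \<zero>\<^bsub>k\<^esub> \<and>
          (\<forall>L. linear_form k L \<longrightarrow> (\<forall>j<?n. L (basis k V u j) = \<zero>\<^bsub>k\<^esub>) \<longrightarrow> L (basis k V v j) = \<zero>\<^bsub>k\<^esub>)"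
      have "?row i' (basis k V v j) = \<zero>\<^bsub>k\<^esub>" if i': "i' < Suc i" and j: "j < ?n" for i' j
      proof (cases "i' = i")
        case True
        then show ?thesis using r j by blast
      next
        case False
        then have "\<forall>j<?n. ?row i' (basis k V u j) = \<zero>\<^bsub>k\<^esub>" using u(5) i' by simp
        with r j linear_form_row[OF k s] show ?thesis by blast
      qed
      then show "n \<le> ?b \<and> ?I (Suc i) (nset v ''i'' (Suc i))"
        using nb xv by simp
    qed
  qed auto
  have i: "wp k (init_prog V) ?s (\<lambda>n t. (n = 0 \<and>
     (\<forall>j<?n. basis k V t j = (\<lambda>l. if l = j then \<one>\<^bsub>k\<^esub> else \<zero>\<^bsub>k\<^esub>))) \<and>
     frame (nwr (init_prog V)) (fwr (init_prog V)) ?s t \<and> in_field k t)"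
    using wp_frame[OF k s' wp_init[OF k s', of V]] V by simp
  have "wp k (init_prog V) ?s (\<lambda>n1 t. wp k (For ''i'' ''N'' ?c) t (\<lambda>n2 u. wp k (search_prog V) u
    (\<lambda>n3 v. n1 + (n2 + n3) \<le> N * ?b + ?n * ?n \<and> fst v ''n'' = ?n \<and>
     solves k N (snd s ''P0'') (snd s ''P1'') (snd s U) (snd s W) m
       (\<lambda>l. snd v V (fst v ''q'' * fst v ''n'' + l)))))"
  proof (rule wp_mono[OF i], elim conjE)
    fix n1 :: nat and t
    assume n1: "n1 = 0" and un: "\<forall>j<?n. basis k V t j = (\<lambda>l. if l = j then \<one>\<^bsub>k\<^esub> else \<zero>\<^bsub>k\<^esub>)"
      and F: "frame (nwr (init_prog V)) (fwr (init_prog V)) ?s t" and t: "in_field k t"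
    have F': "frame (insert ''n'' (nwr (init_prog V))) (fwr (init_prog V)) s t" and tn: "fst t ''n'' = ?n"
      and tN: "fst t ''N'' = N"
      using F N by (auto simp: frame_def)
    have "basis k V t ` {..<?n} = (\<lambda>j l. if l = j then \<one>\<^bsub>k\<^esub> else \<zero>\<^bsub>k\<^esub>) ` {..<?n}"
      using un by (intro image_cong) auto
    then have "x \<in> lspan k (basis k V t ` {..<?n})"
      using lspan_unit_vectors[OF k x(1,3)] by simp
    note l = loop[OF t F' tn this]
    show "wp k (For ''i'' ''N'' ?c) t (\<lambda>n2 u. wp k (search_prog V) u
      (\<lambda>n3 v. n1 + (n2 + n3) \<le> N * ?b + ?n * ?n \<and> fst v ''n'' = ?n \<and>
       solves k N (snd s ''P0'') (snd s ''P1'') (snd s U) (snd s W) m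
         (\<lambda>l. snd v V (fst v ''q'' * fst v ''n'' + l))))"
    proof (rule wp_mono[OF l], elim conjE)
      fix n2 u
      assume n2: "n2 \<le> fst t ''N'' * ?b" and xu: "x \<in> lspan k (basis k V u ` {..<?n})"
        and r: "\<forall>i'<fst t ''N''. \<forall>j<?n. ?row i' (basis k V u j) = \<zero>\<^bsub>k\<^esub>"
        and G: "frame (insert ''i'' (nwr ?c)) (fwr ?c) t u" and u: "in_field k u"
      have same: "snd u ''zero'' 0 = \<zero>\<^bsub>k\<^esub>" "fst u ''n'' = ?n"
        using frameD[OF G] frameD[OF F'] z tn by (simp_all add: workD[OF A(1)])
      have ex: "\<exists>j<fst u ''n''. basis k V u j \<noteq> (\<lambda>_. \<zero>\<^bsub>k\<^esub>)"
        using lspan_trivial[OF k _ xu] x(2) same(2) by auto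
      show "wp k (search_prog V) u
        (\<lambda>n3 v. n1 + (n2 + n3) \<le> N * ?b + ?n * ?n \<and> fst v ''n'' = ?n \<and>
         solves k N (snd s ''P0'') (snd s ''P1'') (snd s U) (snd s W) m
           (\<lambda>l. snd v V (fst v ''q'' * fst v ''n'' + l)))"
      proof (rule wp_mono[OF wp_frame[OF k u wp_search[OF k u same(1) ex]]], elim conjE)
        fix n3 v
        assume n3: "n3 \<le> fst u ''n'' * (fst u ''n'' * 1)" and q: "fst v ''q'' < fst u ''n''"
          "basis k V u (fst v ''q'') \<noteq> (\<lambda>_. \<zero>\<^bsub>k\<^esub>)"
          and H: "frame (nwr (search_prog V)) (fwr (search_prog V)) u v" and v: "in_field k v"
        have e: "fst v ''n'' = ?n" "snd v = snd u" using H same(2) by (auto simp: frame_def)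
        let ?g = "\<lambda>l. snd v V (fst v ''q'' * fst v ''n'' + l)"
        have g: "basis k V u (fst v ''q'') l = ?g l" if "l < ?n" for l
          using that e same(2) by (simp add: basis_def)
        have "constraint k (snd s ''P0'' i) (snd s ''P1'' i) (snd s U i) (snd s W i) m ?g = \<zero>\<^bsub>k\<^esub>"
          if "i < N" for i
        proof -
          have "?row i ?g = ?row i (basis k V u (fst v ''q''))"
            unfolding row_def by (rule constraint_cong) (use g m in simp)
          also have "\<dots> = \<zero>\<^bsub>k\<^esub>" using r that tN q(1) same(2) by simp
          finally show ?thesis by (simp add: row_def m)
        qed
        moreover have "\<exists>l<?n. ?g l \<noteq> \<zero>\<^bsub>k\<^esub>"
          using q(2) e same(2) by (auto simp: basis_def fun_eq_iff split: if_splits)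
        moreover have "range ?g \<subseteq> carrier k" using v by auto
        ultimately have "solves k N (snd s ''P0'') (snd s ''P1'') (snd s U) (snd s W) m ?g"
          by (auto simp: solves_def)
        moreover have "n1 + (n2 + n3) \<le> N * ?b + ?n * ?n"
          using n1 n2 n3 tN same(2) by simp
        ultimately show "n1 + (n2 + n3) \<le> N * ?b + ?n * ?n \<and> fst v ''n'' = ?n \<and>
          solves k N (snd s ''P0'') (snd s ''P1'') (snd s U) (snd s W) m ?g"
          using e(1) by simp
      qed
    qed
  qed
  then show ?thesis
    unfolding solve_prog_def using m by simp
qed

section \<open>The decoding program\<close>

text \<open>The values of \<open>A\<close> and \<open>B\<close> at the points become the word of the second system.\<close>

definition targets_prog :: com where
  "targets_prog = For ''i'' ''N''
    (Seq (NSet ''o'' (NMul (Var ''q'') (Var ''n'')))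
    (Seq (eval_prog ''V1'' ''r1'')
    (Seq (FCopy (''u2'', Var ''i'') (''r1'', Num 0))
    (Seq (NSet ''o'' (NAdd (NMul (Var ''q'') (Var ''n'')) (Var ''m'')))
    (Seq (eval_prog ''V1'' ''r2'')
         (FCopy (''v2'', Var ''i'') (''r2'', Num 0)))))))"

definition output_prog :: com where
  "output_prog = For ''l'' ''m''
    (Seq (FCopy (''a'', Var ''l'') (''V2'', NAdd (NMul (Var ''q'') (Var ''n'')) (Var ''l'')))
         (FCopy (''b'', Var ''l'') (''V2'', NAdd (NMul (Var ''q'') (Var ''n'')) (NAdd (Var ''m'') (Var ''l'')))))"

text \<open>
  The two systems use different arrays \<open>V1\<close> and \<open>V2\<close>, since each run of the solver expects its
  array to be zero.
\<close>

definition decode_prog :: com where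
  "decode_prog =
     Seq (NSet ''m'' (NAdd (NAdd (Var ''h'') (Var ''e'')) (Num 1)))
    (Seq (solve_prog ''V1'' ''w0'' ''w1'')
    (Seq targets_prog
    (Seq (NSet ''m'' (NAdd (Var ''h'') (Num 1)))
    (Seq (solve_prog ''V2'' ''u2'' ''v2'')
         output_prog))))"

lemma nwr_targets [simp]: "nwr targets_prog = {''i'', ''o'', ''j''}"
  and fwr_targets [simp]: "fwr targets_prog = {''r1'', ''r2'', ''xp'', ''tmp'', ''u2'', ''v2''}"
  by (auto simp: targets_prog_def)

lemma wp_targets:
  assumes k: "field k" and s: "in_field k s"
  shows "wp k targets_prog s (\<lambda>n t. n \<le> fst s ''N'' * (fst s ''m'' * 8) \<and>
     (\<forall>i<fst s ''N''.
        snd t ''u2'' i = homog_eval k (snd s ''P0'' i) (snd s ''P1'' i)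
          (\<lambda>l. snd s ''V1'' (fst s ''q'' * fst s ''n'' + l)) (fst s ''m'') \<and>
        snd t ''v2'' i = homog_eval k (snd s ''P0'' i) (snd s ''P1'' i)
          (\<lambda>l. snd s ''V1'' (fst s ''q'' * fst s ''n'' + (fst s ''m'' + l))) (fst s ''m'')))"
proof -
  let ?c = "Seq (NSet ''o'' (NMul (Var ''q'') (Var ''n'')))
    (Seq (eval_prog ''V1'' ''r1'')
    (Seq (FCopy (''u2'', Var ''i'') (''r1'', Num 0))
    (Seq (NSet ''o'' (NAdd (NMul (Var ''q'') (Var ''n'')) (Var ''m'')))
    (Seq (eval_prog ''V1'' ''r2'')
         (FCopy (''v2'', Var ''i'') (''r2'', Num 0))))))"
  let ?h = "\<lambda>i o'. homog_eval k (snd s ''P0'' i) (snd s ''P1'' i) (\<lambda>l. snd s ''V1'' (o' + l)) (fst s ''m'')"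
  let ?I = "\<lambda>i t. \<forall>i'<i. snd t ''u2'' i' = ?h i' (fst s ''q'' * fst s ''n'') \<and>
     snd t ''v2'' i' = ?h i' (fst s ''q'' * fst s ''n'' + fst s ''m'')"
  have "wp k (For ''i'' ''N'' ?c) s (\<lambda>n t. n \<le> fst s ''N'' * (fst s ''m'' * 8) \<and> ?I (fst s ''N'') t \<and>
     frame (insert ''i'' (nwr ?c)) (fwr ?c) s t \<and> in_field k t)"
  proof (rule wp_For[OF k s, where I = ?I])
    fix i t assume t: "i < fst s ''N''" "in_field k t"
      "frame (insert ''i'' (nwr ?c)) (fwr ?c) s t" "fst t ''i'' = i" "?I i t"
    have same: "fst t ''q'' = fst s ''q''" "fst t ''n'' = fst s ''n''" "fst t ''m'' = fst s ''m''"
      "snd t ''P0'' = snd s ''P0''" "snd t ''P1'' = snd s ''P1''" "snd t ''V1'' = snd s ''V1''"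
      using frameD[OF t(3)] by simp_all
    show "wp k ?c t (\<lambda>n t'. n \<le> fst s ''m'' * 8 \<and> ?I (Suc i) (nset t' ''i'' (Suc i)))"
      unfolding wp_Seq wp_simps
      apply (rule wp_mono, rule wp_eval_frame[OF k])
      subgoal using t(2) by simp
      subgoal by simp
      subgoal by simp
      apply (elim conjE)
      apply (rule wp_mono, rule wp_eval_frame[OF k])
      subgoal by (auto simp del: fget_eq intro!: in_field_fset fget_in_field)
      subgoal by simp
      subgoal by simp
      subgoal premises p for n1 t1 n2 t2
        using p(1,2) conjunct1[OF p(5)] frameD[OF p(3)] frameD[OF conjunct1[OF conjunct2[OF p(5)]]] t(4,5) same by (simp add: less_Suc_eq)
      done
  qed auto
  then show ?thesis
    unfolding targets_prog_def by (auto elim!: wp_mono simp: add.assoc)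
qed

lemma wp_output:
  assumes k: "field k" and s: "in_field k s"
  shows "wp k output_prog s (\<lambda>n t. n = 0 \<and>
     (\<forall>l<fst s ''m''. snd t ''a'' l = snd s ''V2'' (fst s ''q'' * fst s ''n'' + l) \<and>
        snd t ''b'' l = snd s ''V2'' (fst s ''q'' * fst s ''n'' + (fst s ''m'' + l))))"
proof -
  let ?c = "Seq (FCopy (''a'', Var ''l'') (''V2'', NAdd (NMul (Var ''q'') (Var ''n'')) (Var ''l'')))
         (FCopy (''b'', Var ''l'') (''V2'', NAdd (NMul (Var ''q'') (Var ''n'')) (NAdd (Var ''m'') (Var ''l''))))"
  let ?I = "\<lambda>l t. \<forall>l'<l. snd t ''a'' l' = snd s ''V2'' (fst s ''q'' * fst s ''n'' + l') \<and>
        snd t ''b'' l' = snd s ''V2'' (fst s ''q'' * fst s ''n'' + (fst s ''m'' + l'))"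
  have "wp k (For ''l'' ''m'' ?c) s (\<lambda>n t. n \<le> fst s ''m'' * 0 \<and> ?I (fst s ''m'') t \<and>
     frame (insert ''l'' (nwr ?c)) (fwr ?c) s t \<and> in_field k t)"
  proof (rule wp_For[OF k s, where I = ?I])
    fix l t assume t: "frame (insert ''l'' (nwr ?c)) (fwr ?c) s t" "fst t ''l'' = l" "?I l t"
    have same: "fst t ''q'' = fst s ''q''" "fst t ''n'' = fst s ''n''" "fst t ''m'' = fst s ''m''"
      "snd t ''V2'' = snd s ''V2''"
      using frameD[OF t(1)] by simp_all
    show "wp k ?c t (\<lambda>n t'. n \<le> 0 \<and> ?I (Suc l) (nset t' ''l'' (Suc l)))"
      using t(2,3) same by (simp add: less_Suc_eq)
  qed auto
  then show ?thesis
    unfolding output_prog_def by (auto elim!: wp_mono)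
qed

lemma solves_cong:
  assumes "\<And>i. i < N \<Longrightarrow> x i = x' i \<and> y i = y' i \<and> u i = u' i \<and> w i = w' i"
  shows "solves k N x y u w m g \<longleftrightarrow> solves k N x' y' u' w' m g"
  using assms by (auto simp: solves_def)

text \<open>
  That the second system is solvable for each solution \<open>g\<close> of the first is an assumption here: it
  depends on the geometry and not on the program.
\<close>

lemma wp_decode:
  assumes k: "field k" and s: "in_field k s"
    and z: "snd s ''zero'' 0 = \<zero>\<^bsub>k\<^esub>"
      "snd s ''V1'' = (\<lambda>_. \<zero>\<^bsub>k\<^esub>)" "snd s ''V2'' = (\<lambda>_. \<zero>\<^bsub>k\<^esub>)"
    and N: "N = fst s ''N''" and h: "h = fst s ''h''" and e: "e = fst s ''e''"
    and bound: "h + e < N"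
    and sol1: "solves k N (snd s ''P0'') (snd s ''P1'') (snd s ''w0'') (snd s ''w1'') (h + e + 1) g0"
    and sol2: "\<And>g. solves k N (snd s ''P0'') (snd s ''P1'') (snd s ''w0'') (snd s ''w1'') (h + e + 1) g \<Longrightarrow>
       \<exists>g'. solves k N (snd s ''P0'') (snd s ''P1'')
         (\<lambda>i. homog_eval k (snd s ''P0'' i) (snd s ''P1'' i) g (h + e + 1))
         (\<lambda>i. homog_eval k (snd s ''P0'' i) (snd s ''P1'' i) (\<lambda>l. g (h + e + 1 + l)) (h + e + 1)) (h + 1) g'"
  shows "wp k decode_prog s (\<lambda>n t. n \<le> 100 * N ^ 3 \<and>
    (\<exists>g g'. solves k N (snd s ''P0'') (snd s ''P1'') (snd s ''w0'') (snd s ''w1'') (h + e + 1) g \<and>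
       solves k N (snd s ''P0'') (snd s ''P1'')
         (\<lambda>i. homog_eval k (snd s ''P0'' i) (snd s ''P1'' i) g (h + e + 1))
         (\<lambda>i. homog_eval k (snd s ''P0'' i) (snd s ''P1'' i) (\<lambda>l. g (h + e + 1 + l)) (h + e + 1)) (h + 1) g' \<and>
       (\<forall>l<h + 1. snd t ''a'' l = g' l \<and> snd t ''b'' l = g' (h + 1 + l))))"
    (is "wp _ _ _ (\<lambda>n t. n \<le> _ \<and> ?Q t)")
proof -
  interpret field k by fact
  let ?M = "h + e + 1"
  let ?P0 = "snd s ''P0''" and ?P1 = "snd s ''P1''"
  let ?b = "\<lambda>m. N * (2 * m * (m * 8 + 4) + 2 * m * (2 * m * 3)) + 2 * m * (2 * m)"
  let ?sol1 = "solves k N ?P0 ?P1 (snd s ''w0'') (snd s ''w1'') ?M"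
  let ?A = "\<lambda>g i. homog_eval k (?P0 i) (?P1 i) g ?M"
  let ?B = "\<lambda>g i. homog_eval k (?P0 i) (?P1 i) (\<lambda>l. g (?M + l)) ?M"
  let ?s = "nset s ''m'' ?M"
  have s': "in_field k ?s" using s by simp
  have "wp k (solve_prog ''V1'' ''w0'' ''w1'') ?s (\<lambda>n t. n \<le> ?b ?M \<and> fst t ''n'' = 2 * ?M \<and>
     ?sol1 (\<lambda>l. snd t ''V1'' (fst t ''q'' * fst t ''n'' + l)))"
    using wp_solve[OF k s', of "''V1''" "''w0''" "''w1''" N ?M g0] z N sol1 by (simp add: work_def)
  from wp_frame[OF k s' this] obtain n1 t1 where
    x1: "exec k (solve_prog ''V1'' ''w0'' ''w1'') ?s n1 t1" and n1: "n1 \<le> ?b ?M"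
    and t1: "?sol1 (\<lambda>l. snd t1 ''V1'' (fst t1 ''q'' * fst t1 ''n'' + l))"
    and F1: "frame (nwr (solve_prog ''V1'' ''w0'' ''w1'')) (fwr (solve_prog ''V1'' ''w0'' ''w1'')) ?s t1"
    and c1: "in_field k t1"
    unfolding wp_def by blast
  define g where "g = (\<lambda>l. snd t1 ''V1'' (fst t1 ''q'' * fst t1 ''n'' + l))"
  have same1: "fst t1 ''N'' = N" "fst t1 ''h'' = h" "fst t1 ''m'' = ?M" "snd t1 ''P0'' = ?P0"
    "snd t1 ''P1'' = ?P1" "snd t1 ''zero'' 0 = \<zero>\<^bsub>k\<^esub>" "snd t1 ''V2'' = (\<lambda>_. \<zero>\<^bsub>k\<^esub>)"
    using frameD[OF F1] N h z by simp_all
  have "wp k targets_prog t1 (\<lambda>n t. n \<le> N * (?M * 8) \<and>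
     (\<forall>i<N. snd t ''u2'' i = ?A g i \<and> snd t ''v2'' i = ?B g i))"
    using wp_targets[OF k c1] unfolding same1 g_def by simp
  from wp_frame[OF k c1 this] obtain n2 t2 where
    x2: "exec k targets_prog t1 n2 t2" and n2: "n2 \<le> N * (?M * 8)"
    and t2: "\<And>i. i < N \<Longrightarrow> snd t2 ''u2'' i = ?A g i \<and> snd t2 ''v2'' i = ?B g i"
    and F2: "frame (nwr targets_prog) (fwr targets_prog) t1 t2"
    and c2: "in_field k t2"
    unfolding wp_def by blast
  have same2: "fst t2 ''N'' = N" "fst t2 ''h'' = h" "snd t2 ''P0'' = ?P0"
    "snd t2 ''P1'' = ?P1" "snd t2 ''zero'' 0 = \<zero>\<^bsub>k\<^esub>" "snd t2 ''V2'' = (\<lambda>_. \<zero>\<^bsub>k\<^esub>)"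
    using frameD[OF F2] same1 by simp_all
  let ?t2 = "nset t2 ''m'' (h + 1)"
  have c2': "in_field k ?t2" using c2 by simp
  let ?sol2 = "solves k N ?P0 ?P1 (?A g) (?B g) (h + 1)"
  have sol2_eq: "solves k N ?P0 ?P1 (snd t2 ''u2'') (snd t2 ''v2'') (h + 1) g' \<longleftrightarrow> ?sol2 g'" for g'
    by (rule solves_cong) (use t2 in simp)
  obtain g1 where "?sol2 g1" using sol2 t1 unfolding g_def by blast
  then have "wp k (solve_prog ''V2'' ''u2'' ''v2'') ?t2 (\<lambda>n t. n \<le> ?b (h + 1) \<and> fst t ''n'' = 2 * (h + 1) \<and>
     ?sol2 (\<lambda>l. snd t ''V2'' (fst t ''q'' * fst t ''n'' + l)))"
    using wp_solve[OF k c2', of "''V2''" "''u2''" "''v2''" N "h + 1" g1] same2 sol2_eq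
    by (simp add: work_def)
  from wp_frame[OF k c2' this] obtain n3 t3 where
    x3: "exec k (solve_prog ''V2'' ''u2'' ''v2'') ?t2 n3 t3" and n3: "n3 \<le> ?b (h + 1)"
    and t3: "?sol2 (\<lambda>l. snd t3 ''V2'' (fst t3 ''q'' * fst t3 ''n'' + l))"
    and F3: "frame (nwr (solve_prog ''V2'' ''u2'' ''v2'')) (fwr (solve_prog ''V2'' ''u2'' ''v2'')) ?t2 t3"
    and c3: "in_field k t3"
    unfolding wp_def by blast
  define g' where "g' = (\<lambda>l. snd t3 ''V2'' (fst t3 ''q'' * fst t3 ''n'' + l))"
  have same3: "fst t3 ''m'' = h + 1" using frameD[OF F3] by simp
  obtain t4 where x4: "exec k output_prog t3 0 t4"
    and t4: "\<forall>l<h + 1. snd t4 ''a'' l = g' l \<and> snd t4 ''b'' l = g' (h + 1 + l)"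
    using wp_output[OF k c3] unfolding same3 g'_def wp_def by blast
  have y1: "exec k (NSet ''m'' (NAdd (NAdd (Var ''h'') (Var ''e'')) (Num 1))) s 0 ?s"
    using exec.NSet[of k "''m''" "NAdd (NAdd (Var ''h'') (Var ''e'')) (Num 1)" s] h e by simp
  have y2: "exec k (NSet ''m'' (NAdd (Var ''h'') (Num 1))) t2 0 ?t2"
    using exec.NSet[of k "''m''" "NAdd (Var ''h'') (Num 1)" t2] same2(2) by simp
  have "exec k decode_prog s (n1 + n2 + n3) t4"
    using exec.Seq[OF y1 exec.Seq[OF x1 exec.Seq[OF x2 exec.Seq[OF y2 exec.Seq[OF x3 x4]]]]]
    by (simp add: decode_prog_def add.assoc)
  moreover have "n1 + n2 + n3 \<le> 100 * N ^ 3"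
  proof -
    \<comment> \<open>The two runs of the solver cost at most \<open>40 * N ^ 3\<close> each, and the evaluation between them \<open>8 * N ^ 3\<close>.\<close>
    have b: "?b m \<le> 40 * N ^ 3" if "m \<le> N" for m
    proof -
      have "?b m \<le> N * (2 * N * (N * 8 + 4 * N) + 2 * N * (2 * N * 3)) + 2 * N * (2 * N * N)"
        using that bound by (intro add_mono mult_mono) auto
      also have "\<dots> = 40 * N ^ 3" by (simp add: power3_eq_cube algebra_simps)
      finally show ?thesis .
    qed
    have "?M * 8 \<le> N * 8 * N"
    proof (rule order_trans)
      show "?M * 8 \<le> N * 8" using bound by simp
      show "N * 8 \<le> N * 8 * N" using bound by (cases N) simp_all
    qed
    then have "n2 \<le> N * (N * 8 * N)"
      using n2 by (elim order_trans) (rule mult_le_mono2)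
    also have "\<dots> = 8 * N ^ 3" by (simp add: power3_eq_cube)
    finally show ?thesis using b[of ?M] b[of "h + 1"] n1 n3 bound by simp
  qed
  moreover have "?Q t4"
    using t1 t3 t4 unfolding g_def[symmetric] g'_def[symmetric] by blast
  ultimately show ?thesis by (intro wpI) auto
qed

section \<open>Polynomials as forms on the projective line\<close>

text \<open>
  A polynomial as a form of formal degree \<open>m\<close>. At infinity its value is the
  coefficient in degree \<open>m\<close>, which is zero if the actual degree is smaller.
\<close>

fun form_val :: "'a ring \<Rightarrow> nat \<Rightarrow> 'a list \<Rightarrow> 'a proj_pt \<Rightarrow> 'a" where
  "form_val k m p (Aff x) = ring.eval k p x"
| "form_val k m p Infty = ring.coeff k p m"

locale base_field = field k for k :: "'a ring" (structure)
begin

sublocale P: domain "poly_ring k"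
  using univ_poly_is_domain[OF carrier_is_subring] .

abbreviation "Pol \<equiv> carrier (poly_ring k)"

lemma Pol_set: "p \<in> Pol \<Longrightarrow> set p \<subseteq> carrier k"
  using polynomial_in_carrier[OF carrier_is_subring] by (simp add: univ_poly_carrier)

lemma coeff_closed: "p \<in> Pol \<Longrightarrow> coeff p i \<in> carrier k"
  using Pol_set by simp

lemma form_val_closed:
  assumes "p \<in> Pol" "P \<in> proj_line k"
  shows "form_val k m p P \<in> carrier k"
  using assms eval_in_carrier[OF Pol_set] coeff_closed by (auto simp: proj_line_def)

lemma degree_mult:
  assumes "p \<in> Pol" "q \<in> Pol" "p \<noteq> []" "q \<noteq> []"
  shows "degree (p \<otimes>\<^bsub>poly_ring k\<^esub> q) = degree p + degree q"
  using poly_mult_degree_eq[OF carrier_is_subring] assms by (simp add: univ_poly_mult univ_poly_carrier)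

lemma degree_mult_le:
  assumes "p \<in> Pol" "q \<in> Pol"
  shows "degree (p \<otimes>\<^bsub>poly_ring k\<^esub> q) \<le> degree p + degree q"
  using poly_mult_degree_eq[OF carrier_is_subring, of p q] assms
  by (simp add: univ_poly_mult univ_poly_carrier)

lemma mult_nonzero:
  assumes "p \<in> Pol" "q \<in> Pol"
  shows "p \<otimes>\<^bsub>poly_ring k\<^esub> q = [] \<longleftrightarrow> p = [] \<or> q = []"
  using P.integral_iff[OF assms] by (simp add: univ_poly_zero)

text \<open>
  If one of the degrees is smaller than its formal degree, then both sides are zero; this is the
  multiplicativity of forms at infinity.
\<close>

lemma coeff_mult_top:
  assumes p: "p \<in> Pol" "degree p \<le> m" and q: "q \<in> Pol" "degree q \<le> n"
  shows "coeff (p \<otimes>\<^bsub>poly_ring k\<^esub> q) (m + n) = coeff p m \<otimes> coeff q n"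
proof (cases "p = [] \<or> q = []")
  case True
  then have "p \<otimes>\<^bsub>poly_ring k\<^esub> q = []" using mult_nonzero p(1) q(1) by simp
  then show ?thesis using True coeff_closed[OF p(1)] coeff_closed[OF q(1)] by auto
next
  case False
  show ?thesis
  proof (cases "degree p = m \<and> degree q = n")
    case True
    have "p \<otimes>\<^bsub>poly_ring k\<^esub> q \<noteq> []" using mult_nonzero p(1) q(1) False by simp
    then have "coeff (p \<otimes>\<^bsub>poly_ring k\<^esub> q) (m + n) = lead_coeff (p \<otimes>\<^bsub>poly_ring k\<^esub> q)"
      using lead_coeff_simp degree_mult[OF p(1) q(1)] False True by metis
    also have "\<dots> = lead_coeff p \<otimes> lead_coeff q"
      using poly_mult_lead_coeff[OF carrier_is_subring] p(1) q(1) False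
      by (simp add: univ_poly_mult univ_poly_carrier)
    also have "\<dots> = coeff p m \<otimes> coeff q n"
      using lead_coeff_simp False True by metis
    finally show ?thesis .
  next
    case F: False
    then have "degree p < m \<or> degree q < n" using p(2) q(2) by auto
    moreover have "coeff (p \<otimes>\<^bsub>poly_ring k\<^esub> q) (m + n) = \<zero>"
      using degree_mult[OF p(1) q(1)] False F p(2) q(2) by (intro coeff_degree) auto
    ultimately show ?thesis
      using coeff_degree coeff_closed[OF p(1)] coeff_closed[OF q(1)] by auto
  qed
qed

lemma form_val_mult:
  assumes p: "p \<in> Pol" "degree p \<le> m" and q: "q \<in> Pol" "degree q \<le> n" and P: "P \<in> proj_line k"
  shows "form_val k (m + n) (p \<otimes>\<^bsub>poly_ring k\<^esub> q) P = form_val k m p P \<otimes> form_val k n q P"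
proof (cases P)
  case (Aff x)
  then have "x \<in> carrier k" using P by (auto simp: proj_line_def)
  then show ?thesis
    using Aff ring_hom_mult[OF eval_is_hom[OF carrier_is_subring] p(1) q(1)] by simp
next
  case Infty
  then show ?thesis using coeff_mult_top[OF p q] by simp
qed

lemma form_val_add:
  assumes p: "p \<in> Pol" "q \<in> Pol" "P \<in> proj_line k"
  shows "form_val k m (p \<oplus>\<^bsub>poly_ring k\<^esub> q) P = form_val k m p P \<oplus> form_val k m q P"
proof (cases P)
  case (Aff x)
  then have "x \<in> carrier k" using assms by (auto simp: proj_line_def)
  then show ?thesis
    using Aff ring_hom_add[OF eval_is_hom[OF carrier_is_subring] p(1) p(2)] by simp
next
  case Infty
  then show ?thesis
    using poly_add_coeff[OF Pol_set[OF p(1)] Pol_set[OF p(2)]] by (simp add: univ_poly_add)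
qed

lemma form_val_mono:
  assumes "p \<in> Pol" "degree p \<le> m" "m \<le> n" "P \<in> proj_line k" "form_val k m p P = \<zero>"
  shows "form_val k n p P = \<zero>"
proof (cases P)
  case Infty
  then show ?thesis using assms coeff_degree[of p n] by (cases "m = n") auto
qed (use assms in auto)

lemma card_set_mset_le: "card (set_mset M) \<le> size M"
  by (induction M) (auto simp: card_insert_if)

text \<open>
  A zero at infinity lowers the actual degree by at least one, and the remaining zeros are roots of the polynomial.
\<close>

lemma form_zeros:
  assumes p: "p \<in> Pol" "degree p \<le> m" and S: "S \<subseteq> proj_line k" "finite S" "card S > m"
    and z: "\<And>P. P \<in> S \<Longrightarrow> form_val k m p P = \<zero>"
  shows "p = []"
proof (rule ccontr)
  assume p0: "p \<noteq> []"
  let ?T = "{x. Aff x \<in> S}"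
  have fT: "finite ?T"
    using finite_vimageI[OF S(2), of Aff] by (simp add: vimage_def inj_on_def)
  have "?T \<subseteq> set_mset (roots p)"
  proof
    fix x assume x: "x \<in> ?T"
    then have "x \<in> carrier k" using S(1) by (auto simp: proj_line_def)
    moreover have "eval p x = \<zero>" using z[of "Aff x"] x by simp
    ultimately show "x \<in> set_mset (roots p)"
      using p0 by (simp add: roots_mem_iff_is_root[OF p(1)] is_root_def)
  qed
  then have T: "card ?T \<le> degree p"
    using card_mono[OF finite_set_mset] card_set_mset_le size_roots_le_degree[OF p(1)]
    by (meson order_trans)
  show False
  proof (cases "Infty \<in> S")
    case True
    then have "coeff p m = \<zero>" using z[OF True] by simp
    moreover have "lead_coeff p \<noteq> \<zero>"
      using p(1) p0 unfolding univ_poly_carrier[symmetric] polynomial_def by auto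
    ultimately have "degree p \<noteq> m" using lead_coeff_simp[OF p0] by auto
    then have d: "degree p < m" using p(2) by simp
    have "S \<subseteq> insert Infty (Aff ` ?T)" using S(1) by (auto simp: proj_line_def)
    then have "card S \<le> card (insert Infty (Aff ` ?T))" using fT by (intro card_mono) auto
    also have "\<dots> \<le> Suc (card ?T)" using card_image_le[OF fT, of Aff] fT
      by (intro order_trans[OF card_insert_le_m1]) auto
    finally show False using T d S(3) by simp
  next
    case False
    then have "S \<subseteq> Aff ` ?T" using S(1) by (auto simp: proj_line_def)
    then have "card S \<le> card ?T" using fT card_mono[of "Aff ` ?T" S] card_image_le[OF fT, of Aff] by simp
    then show False using T p(2) S(3) by simp
  qed
qed

text \<open>Both sides are forms of degree \<open>m + n\<close>, so more than \<open>m + n\<close> common values make them equal.\<close>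

lemma cross_eq:
  assumes AB: "A \<in> Pol" "degree A \<le> m" "B \<in> Pol" "degree B \<le> m"
    and ab: "a \<in> Pol" "degree a \<le> n" "b \<in> Pol" "degree b \<le> n"
    and S: "S \<subseteq> proj_line k" "finite S" "card S > m + n"
    and z: "\<And>P. P \<in> S \<Longrightarrow> form_val k m A P \<otimes> form_val k n b P = form_val k m B P \<otimes> form_val k n a P"
  shows "A \<otimes>\<^bsub>poly_ring k\<^esub> b = B \<otimes>\<^bsub>poly_ring k\<^esub> a"
proof -
  let ?p = "A \<otimes>\<^bsub>poly_ring k\<^esub> b" and ?q = "B \<otimes>\<^bsub>poly_ring k\<^esub> a"
  let ?d = "?p \<ominus>\<^bsub>poly_ring k\<^esub> ?q"
  have c: "?p \<in> Pol" "?q \<in> Pol" "?d \<in> Pol" using AB ab by auto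
  have "degree ?d \<le> max (degree ?p) (degree (\<ominus>\<^bsub>poly_ring k\<^esub> ?q))"
    using poly_add_degree by (simp add: a_minus_def univ_poly_add)
  also have "degree (\<ominus>\<^bsub>poly_ring k\<^esub> ?q) = degree ?q"
    by (rule univ_poly_a_inv_degree[OF carrier_is_subring c(2)])
  also have "max (degree ?p) (degree ?q) \<le> m + n"
    using degree_mult_le[OF AB(1) ab(3)] degree_mult_le[OF AB(3) ab(1)] AB ab by simp
  finally have d: "degree ?d \<le> m + n" .
  have "form_val k (m + n) ?d P = \<zero>" if "P \<in> S" for P
  proof -
    have P: "P \<in> proj_line k" using that S by auto
    have "?d \<oplus>\<^bsub>poly_ring k\<^esub> ?q = ?p"
      using c by (simp add: P.minus_eq P.a_assoc P.l_neg)
    then have "form_val k (m + n) ?d P \<oplus> form_val k (m + n) ?q P = form_val k (m + n) ?p P"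
      using form_val_add[OF c(3,2) P] by simp
    also have "\<dots> = form_val k (m + n) ?q P"
      using form_val_mult[OF AB(1,2) ab(3,4) P] form_val_mult[OF AB(3,4) ab(1,2) P] z[OF that] by simp
    finally show ?thesis using form_val_closed[OF c(3) P] form_val_closed[OF c(2) P] by simp
  qed
  then have "?d = []" using form_zeros[OF c(3) d S] by blast
  then show ?thesis using P.r_right_minus_eq[OF c(1,2)] by (simp add: univ_poly_zero)
qed

text \<open>
  The product of one linear form for each point: \<open>X - x\<close> for an affine point \<open>x\<close>, and for infinity
  the constant 1, which as a form of degree 1 is the second coordinate.
\<close>

lemma locator_exists:
  assumes "finite S" "S \<subseteq> proj_line k"
  shows "\<exists>E\<in>Pol. E \<noteq> [] \<and> degree E \<le> card S \<and> (\<forall>P\<in>S. form_val k (card S) E P = \<zero>)"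
  using assms
proof (induction S)
  case empty
  have "\<one>\<^bsub>poly_ring k\<^esub> \<in> Pol" by simp
  then show ?case by (intro bexI[of _ "\<one>\<^bsub>poly_ring k\<^esub>"]) (auto simp: univ_poly_one)
next
  case (insert Q S)
  then obtain E where E: "E \<in> Pol" "E \<noteq> []" "degree E \<le> card S"
    "\<And>P. P \<in> S \<Longrightarrow> form_val k (card S) E P = \<zero>" by auto
  obtain L where L: "L \<in> Pol" "L \<noteq> []" "degree L \<le> 1" "form_val k 1 L Q = \<zero>"
  proof (cases Q)
    case (Aff x)
    then have x: "x \<in> carrier k" using insert.prems by (auto simp: proj_line_def)
    have "[\<one>, \<ominus> x] \<in> Pol"
      using x by (auto simp: univ_poly_carrier[symmetric] polynomial_def)
    moreover have "eval [\<one>, \<ominus> x] x = \<zero>" using x by (simp add: r_neg)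
    ultimately show ?thesis using that[of "[\<one>, \<ominus> x]"] Aff by simp
  next
    case Infty
    have "[\<one>] \<in> Pol" using P.one_closed by (simp add: univ_poly_one)
    then show ?thesis using that[of "[\<one>]"] Infty by simp
  qed
  let ?E = "L \<otimes>\<^bsub>poly_ring k\<^esub> E"
  have "form_val k (1 + card S) ?E P = \<zero>" if "P \<in> insert Q S" for P
  proof -
    have P: "P \<in> proj_line k" using that insert.prems by auto
    show ?thesis
      using form_val_mult[OF L(1,3) E(1,3) P] that L(4) E(4) form_val_closed[OF L(1) P]
        form_val_closed[OF E(1) P] by auto
  qed
  moreover have "?E \<noteq> []" "degree ?E \<le> 1 + card S" "?E \<in> Pol"
    using mult_nonzero[OF L(1) E(1)] degree_mult_le[OF L(1) E(1)] L E by auto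
  ultimately show ?case using insert.hyps by (intro bexI[of _ ?E]) auto
qed

lemma read_poly_closed: "range u \<subseteq> carrier k \<Longrightarrow> read_poly k d u \<in> Pol"
  unfolding read_poly_def univ_poly_carrier[symmetric]
  by (intro normalize_gives_polynomial) auto

lemma coeff_read_poly:
  "coeff (read_poly k d u) i = (if i \<le> d then u i else \<zero>)"
proof -
  have "coeff (read_poly k d u) i = coeff (map u (rev [0..<Suc d])) i"
    unfolding read_poly_def using normalize_coeff by metis
  also have "\<dots> = (if i \<le> d then u i else \<zero>)"
  proof (cases "i \<le> d")
    case True
    then show ?thesis by (subst coeff_nth) (auto simp: rev_nth simp del: upt_Suc)
  next
    case False
    then show ?thesis by (subst coeff_length) (auto simp del: upt_Suc)
  qed
  finally show ?thesis .
qed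

lemma degree_read_poly: "degree (read_poly k d u) \<le> d"
  unfolding read_poly_def using normalize_length_le[of "map u (rev [0..<Suc d])"] by simp

lemma read_poly_coeff:
  assumes p: "p \<in> Pol" "degree p \<le> d" and u: "\<And>i. i \<le> d \<Longrightarrow> u i = coeff p i" "range u \<subseteq> carrier k"
  shows "read_poly k d u = p"
proof -
  have "coeff (read_poly k d u) = coeff p"
    using p(2) u(1) coeff_degree[of p] by (auto simp: coeff_read_poly fun_eq_iff)
  then show ?thesis
    using coeff_iff_polynomial_cond[of "carrier k"] read_poly_closed[OF u(2), of d] p(1)
    by (simp add: univ_poly_carrier)
qed

lemma read_poly_eq_Nil:
  assumes "range u \<subseteq> carrier k"
  shows "read_poly k d u = [] \<longleftrightarrow> (\<forall>i\<le>d. u i = \<zero>)"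
proof
  assume "read_poly k d u = []"
  then show "\<forall>i\<le>d. u i = \<zero>" using coeff_read_poly[of d u] by (auto split: if_splits) metis
next
  assume "\<forall>i\<le>d. u i = \<zero>"
  then show "read_poly k d u = []"
    using assms by (intro read_poly_coeff) (auto simp: univ_poly_zero_closed)
qed

text \<open>
  The bridge between the program, which evaluates forms at coordinates, and polynomials.
\<close>

lemma homog_eval_form_val:
  assumes u: "range u \<subseteq> carrier k" and P: "P \<in> proj_line k"
  shows "homog_eval k (coord0 k P) (coord1 k P) u (Suc d) = form_val k d (read_poly k d u) P"
proof (cases P)
  case (Aff x)
  then have x: "x \<in> carrier k" using P by (auto simp: proj_line_def)
  have ul: "\<And>l. u l \<in> carrier k" using u by auto
  have "homog_eval k x \<one> u m = eval (map u (rev [0..<m])) x \<and> homog_eval k x \<one> u m \<in> carrier k" for m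
    by (induction m) (auto simp: x ul a_comm)
  then have "homog_eval k x \<one> u (Suc d) = eval (map u (rev [0..<Suc d])) x" by blast
  also have "\<dots> = eval (read_poly k d u) x"
    unfolding read_poly_def using u x by (intro eval_normalize[symmetric]) auto
  finally show ?thesis using Aff by (simp del: homog_eval.simps)
next
  case Infty
  have "u d \<in> carrier k" using u by auto
  moreover have "homog_eval k \<one> \<zero> u d \<in> carrier k"
    using homog_eval_closed[OF _ _ _ u] field_axioms by simp
  ultimately show ?thesis using Infty by (simp add: coeff_read_poly)
qed

section \<open>Fractions and their values\<close>

lemma frac_rel_equiv: "equiv (Pol \<times> (Pol - {\<zero>\<^bsub>poly_ring k\<^esub>})) (frac_rel k)"
proof (rule equivI)
  show "frac_rel k \<subseteq> (Pol \<times> (Pol - {\<zero>\<^bsub>poly_ring k\<^esub>})) \<times> (Pol \<times> (Pol - {\<zero>\<^bsub>poly_ring k\<^esub>}))"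
    by (auto simp: frac_rel_def)
  show "refl_on (Pol \<times> (Pol - {\<zero>\<^bsub>poly_ring k\<^esub>})) (frac_rel k)"
    by (auto simp: refl_on_def frac_rel_def)
  show "sym (frac_rel k)"
    by (auto simp: sym_def frac_rel_def)
  show "trans (frac_rel k)"
  proof (rule transI)
    fix x y z assume xy: "(x, y) \<in> frac_rel k" and yz: "(y, z) \<in> frac_rel k"
    obtain a b c d e f where [simp]: "x = (a, b)" "y = (c, d)" "z = (e, f)"
      by (metis surj_pair)
    have c: "a \<in> Pol" "b \<in> Pol" "b \<noteq> \<zero>\<^bsub>poly_ring k\<^esub>" "c \<in> Pol" "d \<in> Pol" "d \<noteq> \<zero>\<^bsub>poly_ring k\<^esub>"
      "e \<in> Pol" "f \<in> Pol" "f \<noteq> \<zero>\<^bsub>poly_ring k\<^esub>"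
      and 1: "a \<otimes>\<^bsub>poly_ring k\<^esub> d = c \<otimes>\<^bsub>poly_ring k\<^esub> b"
      and 2: "c \<otimes>\<^bsub>poly_ring k\<^esub> f = e \<otimes>\<^bsub>poly_ring k\<^esub> d"
      using xy yz by (auto simp: frac_rel_def)
    have "d \<otimes>\<^bsub>poly_ring k\<^esub> (a \<otimes>\<^bsub>poly_ring k\<^esub> f) = (a \<otimes>\<^bsub>poly_ring k\<^esub> d) \<otimes>\<^bsub>poly_ring k\<^esub> f"
      using c by (simp add: P.m_ac)
    also have "\<dots> = (c \<otimes>\<^bsub>poly_ring k\<^esub> f) \<otimes>\<^bsub>poly_ring k\<^esub> b"
      using c unfolding 1 by (simp add: P.m_ac)
    also have "\<dots> = d \<otimes>\<^bsub>poly_ring k\<^esub> (e \<otimes>\<^bsub>poly_ring k\<^esub> b)"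
      using c unfolding 2 by (simp add: P.m_ac)
    finally have "a \<otimes>\<^bsub>poly_ring k\<^esub> f = e \<otimes>\<^bsub>poly_ring k\<^esub> b"
      using P.m_lcancel[OF c(6,5)] c by simp
    then show "(x, z) \<in> frac_rel k" using c by (simp add: frac_rel_def)
  qed
qed

lemma frac_eq:
  assumes f: "f \<in> rat_funs k" and ab: "(a, b) \<in> f"
    and AB: "A \<in> Pol" "B \<in> Pol" "B \<noteq> []"
    and eq: "A \<otimes>\<^bsub>poly_ring k\<^esub> b = B \<otimes>\<^bsub>poly_ring k\<^esub> a"
  shows "frac k A B = f"
proof -
  obtain p where p: "f = frac_rel k `` {p}" "p \<in> Pol \<times> (Pol - {\<zero>\<^bsub>poly_ring k\<^esub>})"
    using f unfolding rat_funs_def quotient_def by auto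
  have 1: "(p, (a, b)) \<in> frac_rel k" using ab p by simp
  then have c: "a \<in> Pol" "b \<in> Pol" "b \<noteq> \<zero>\<^bsub>poly_ring k\<^esub>"
    by (cases p; auto simp: frac_rel_def)+
  have "((A, B), (a, b)) \<in> frac_rel k"
    using c AB eq P.m_comm[of a B] by (simp add: frac_rel_def univ_poly_zero)
  from equiv_class_eq[OF frac_rel_equiv this] equiv_class_eq[OF frac_rel_equiv 1] p
  show ?thesis by (simp add: frac_def)
qed

lemma lowest_terms_props:
  assumes f: "f \<in> rat_funs k" and l: "lowest_terms k f = (a, b)"
  shows "(a, b) \<in> f" "a \<in> Pol" "b \<in> Pol" "b \<noteq> []" "degree a \<le> rf_degree k f" "degree b \<le> rf_degree k f"
proof -
  show ab: "(a, b) \<in> f"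
    using someI_ex[OF lowest_terms_exists[OF field_axioms f]] l unfolding lowest_terms_def by simp
  obtain p where "f = frac_rel k `` {p}"
    using f unfolding rat_funs_def quotient_def by auto
  with ab have "(p, (a, b)) \<in> frac_rel k" by simp
  then show "a \<in> Pol" "b \<in> Pol" "b \<noteq> []"
    by (cases p; auto simp: frac_rel_def univ_poly_zero)+
  show "degree a \<le> rf_degree k f" "degree b \<le> rf_degree k f"
    by (auto simp: rf_degree_def l)
qed

lemma coord_closed:
  assumes "w \<in> proj_line k"
  shows "coord0 k w \<in> carrier k" "coord1 k w \<in> carrier k"
  using assms by (auto simp: proj_line_def)

text \<open>
  Cross-multiplication turns the values of rational functions into linear conditions on numerator
  and denominator, which treat poles and other values alike.
\<close>

lemma rf_eval_cross:
  assumes f: "f \<in> rat_funs k" and l: "lowest_terms k f = (a, b)"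
    and P: "P \<in> proj_line k" and w: "rf_eval k f P = w"
  shows "form_val k (rf_degree k f) a P \<otimes> coord1 k w = form_val k (rf_degree k f) b P \<otimes> coord0 k w"
proof -
  let ?u = "form_val k (rf_degree k f) a P" and ?v = "form_val k (rf_degree k f) b P"
  have c: "?u \<in> carrier k" "?v \<in> carrier k"
    using lowest_terms_props[OF f l] form_val_closed P by auto
  have "w = proj_quot k ?u ?v"
    using w l by (cases P) auto
  then show ?thesis
  proof (cases "?v = \<zero>")
    case True
    then show ?thesis using \<open>w = _\<close> c by (simp add: proj_quot_def)
  next
    case False
    then have "?v \<in> Units k" using c field_Units by simp
    then have "?v \<otimes> (?u \<otimes> inv ?v) = ?u"
      using c by (simp add: m_lcomm)
    then show ?thesis using \<open>w = _\<close> c False by (simp add: proj_quot_def)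
  qed
qed

text \<open>Two pairs proportional to the same point \<open>w\<close> of the projective line are proportional to each other.\<close>

lemma cross_trans:
  assumes w: "w \<in> proj_line k" and c: "p \<in> carrier k" "q \<in> carrier k" "r \<in> carrier k" "s \<in> carrier k"
    and 1: "p \<otimes> coord1 k w = q \<otimes> coord0 k w" and 2: "r \<otimes> coord1 k w = s \<otimes> coord0 k w"
  shows "p \<otimes> s = q \<otimes> r"
proof (cases w)
  case (Aff u)
  then have "u \<in> carrier k" "p = q \<otimes> u" "r = s \<otimes> u" using w c 1 2 by (auto simp: proj_line_def)
  then show ?thesis using c by (simp add: m_ac)
next
  case Infty
  then have "q = \<zero>" "s = \<zero>" using c 1 2 by auto
  then show ?thesis using c by simp
qed

end

context base_field
begin

section \<open>The key equation\<close>

definition pair_vec :: "nat \<Rightarrow> 'a list \<Rightarrow> 'a list \<Rightarrow> nat \<Rightarrow> 'a" where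
  "pair_vec d p q = (\<lambda>l. if l \<le> d then coeff p l else coeff q (l - Suc d))"

definition solution ::
  "nat \<Rightarrow> 'a proj_pt list \<Rightarrow> nat \<Rightarrow> (nat \<Rightarrow> 'a) \<Rightarrow> (nat \<Rightarrow> 'a) \<Rightarrow> 'a list \<Rightarrow> 'a list \<Rightarrow> bool" where
  "solution N Ps d u w p q \<longleftrightarrow> p \<in> Pol \<and> q \<in> Pol \<and> degree p \<le> d \<and> degree q \<le> d \<and> (p \<noteq> [] \<or> q \<noteq> []) \<and>
     (\<forall>i<N. form_val k d p (Ps ! i) \<otimes> w i = form_val k d q (Ps ! i) \<otimes> u i)"

abbreviation solves_at where
  "solves_at N Ps d u w \<equiv> solves k N (\<lambda>i. coord0 k (Ps ! i)) (\<lambda>i. coord1 k (Ps ! i)) u w (Suc d)"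

lemma solves_imp_solution:
  assumes s: "solves_at N Ps d u w g"
    and Ps: "\<And>i. i < N \<Longrightarrow> Ps ! i \<in> proj_line k"
    and uw: "\<And>i. i < N \<Longrightarrow> u i \<in> carrier k \<and> w i \<in> carrier k"
  shows "solution N Ps d u w (read_poly k d g) (read_poly k d (\<lambda>l. g (Suc d + l)))"
proof -
  have g: "range g \<subseteq> carrier k" "range (\<lambda>l. g (Suc d + l)) \<subseteq> carrier k"
    using s by (auto simp: solves_def)
  obtain l where l: "l < 2 * Suc d" "g l \<noteq> \<zero>" using s by (auto simp: solves_def)
  have nz: "read_poly k d g \<noteq> [] \<or> read_poly k d (\<lambda>l. g (Suc d + l)) \<noteq> []"
  proof (cases "l \<le> d")
    case True
    then show ?thesis using l read_poly_eq_Nil[OF g(1)] by auto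
  next
    case False
    then have "l - Suc d \<le> d" "Suc d + (l - Suc d) = l" using l(1) by auto
    then show ?thesis using l(2) read_poly_eq_Nil[OF g(2)] by metis
  qed
  have "form_val k d (read_poly k d g) (Ps ! i) \<otimes> w i =
      form_val k d (read_poly k d (\<lambda>l. g (Suc d + l))) (Ps ! i) \<otimes> u i" (is "?x \<otimes> _ = ?y \<otimes> _") if i: "i < N" for i
  proof -
    have "constraint k (coord0 k (Ps ! i)) (coord1 k (Ps ! i)) (u i) (w i) (Suc d) g = \<zero>"
      using s i by (simp add: solves_def)
    then have "?x \<otimes> w i \<ominus> ?y \<otimes> u i = \<zero>"
      unfolding constraint_def homog_eval_form_val[OF g(1) Ps[OF i]] homog_eval_form_val[OF g(2) Ps[OF i]] .
    moreover have "?x \<in> carrier k" "?y \<in> carrier k"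
      using form_val_closed read_poly_closed g Ps[OF i] by auto
    ultimately show ?thesis using uw[OF i] by simp
  qed
  then show ?thesis
    using nz degree_read_poly read_poly_closed[OF g(1)] read_poly_closed[OF g(2)]
    by (simp add: solution_def)
qed

lemma solution_imp_solves:
  assumes s: "solution N Ps d u w p q" and q: "q \<noteq> []"
    and Ps: "\<And>i. i < N \<Longrightarrow> Ps ! i \<in> proj_line k"
    and uw: "\<And>i. i < N \<Longrightarrow> u i \<in> carrier k \<and> w i \<in> carrier k"
  shows "solves_at N Ps d u w (pair_vec d p q)"
proof -
  have pq: "p \<in> Pol" "q \<in> Pol" "degree p \<le> d" "degree q \<le> d" using s by (auto simp: solution_def)
  have g: "range (pair_vec d p q) \<subseteq> carrier k" "range (\<lambda>l. pair_vec d p q (Suc d + l)) \<subseteq> carrier k"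
    using pq coeff_closed by (auto simp: pair_vec_def)
  have r: "read_poly k d (pair_vec d p q) = p" "read_poly k d (\<lambda>l. pair_vec d p q (Suc d + l)) = q"
    by (rule read_poly_coeff[OF pq(1,3) _ g(1)], simp add: pair_vec_def)
       (rule read_poly_coeff[OF pq(2,4) _ g(2)], simp add: pair_vec_def)
  have "pair_vec d p q (Suc d + degree q) \<noteq> \<zero>"
  proof -
    have "lead_coeff q \<noteq> \<zero>"
      using pq(2) q unfolding univ_poly_carrier[symmetric] polynomial_def by auto
    then show ?thesis using lead_coeff_simp[OF q] by (simp add: pair_vec_def)
  qed
  moreover have "Suc d + degree q < 2 * Suc d" using pq by simp
  ultimately have "\<exists>l<2 * Suc d. pair_vec d p q l \<noteq> \<zero>" by blast
  moreover have "constraint k (coord0 k (Ps ! i)) (coord1 k (Ps ! i)) (u i) (w i) (Suc d) (pair_vec d p q) = \<zero>"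
    if i: "i < N" for i
  proof -
    have "form_val k d q (Ps ! i) \<in> carrier k" using form_val_closed[OF pq(2) Ps[OF i]] .
    then show ?thesis
      using s i uw[OF i]
      unfolding constraint_def homog_eval_form_val[OF g(1) Ps[OF i]] homog_eval_form_val[OF g(2) Ps[OF i]] r
      by (simp add: solution_def)
  qed
  ultimately show ?thesis using g by (simp add: solves_def)
qed

lemma solution_denominator_nonzero:
  assumes "A \<in> Pol" "B \<in> Pol" "a \<in> Pol" "b \<in> Pol" "b \<noteq> []" "A \<noteq> [] \<or> B \<noteq> []"
    and "A \<otimes>\<^bsub>poly_ring k\<^esub> b = B \<otimes>\<^bsub>poly_ring k\<^esub> a"
  shows "B \<noteq> []"
  using assms mult_nonzero[of A b] mult_nonzero[of B a] by auto

context
  fixes Ps ws :: "'a proj_pt list" and N h e :: nat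
  assumes len: "length Ps = N" "length ws = N" and dist: "distinct Ps"
    and sub: "set Ps \<subseteq> proj_line k" "set ws \<subseteq> proj_line k" and bound: "2 * (h + e) < N"
begin

abbreviation "w0 \<equiv> \<lambda>i. coord0 k (ws ! i)"
abbreviation "w1 \<equiv> \<lambda>i. coord1 k (ws ! i)"

lemma Ps_nth: "i < N \<Longrightarrow> Ps ! i \<in> proj_line k"
  using sub len by auto

lemma ws_nth: "i < N \<Longrightarrow> ws ! i \<in> proj_line k"
  using sub len by (metis nth_mem subsetD)

lemma w_closed: "i < N \<Longrightarrow> w0 i \<in> carrier k \<and> w1 i \<in> carrier k"
  using coord_closed[OF ws_nth] by auto

text \<open>
  The solution is \<open>(a E, b E)\<close>, where \<open>f = a / b\<close> in lowest terms and \<open>E\<close> locates the errors. The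
  formal degree of \<open>E\<close> is raised to \<open>h + e - d\<close>, where \<open>d\<close> is the degree of \<open>f\<close>, as the products
  must be forms of degree \<open>h + e\<close> also at infinity.
\<close>

lemma decoding_exists_solution:
  assumes f: "f \<in> decodings k Ps h e ws"
  shows "\<exists>p q. solution N Ps (h + e) w0 w1 p q \<and> q \<noteq> []"
proof -
  obtain a b where l: "lowest_terms k f = (a, b)" by force
  let ?d = "rf_degree k f"
  let ?r = "h + e - ?d"
  have fr: "f \<in> rat_funs k" and d: "?d \<le> h"
    and err: "card {i. i < N \<and> rf_eval k f (Ps ! i) \<noteq> ws ! i} \<le> e"
    using f len by (auto simp: decodings_def)
  note lp = lowest_terms_props[OF fr l]
  let ?S = "(\<lambda>i. Ps ! i) ` {i. i < N \<and> rf_eval k f (Ps ! i) \<noteq> ws ! i}"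
  have fin: "finite ?S" by simp
  have cS: "card ?S \<le> ?r"
    using card_image_le[of "{i. i < N \<and> rf_eval k f (Ps ! i) \<noteq> ws ! i}" "\<lambda>i. Ps ! i"] err d by simp
  have S: "?S \<subseteq> proj_line k" using Ps_nth by auto
  obtain E where E: "E \<in> Pol" "E \<noteq> []" "degree E \<le> card ?S"
    "\<And>P. P \<in> ?S \<Longrightarrow> form_val k (card ?S) E P = \<zero>"
    using locator_exists[OF fin S] by blast
  have E0: "form_val k ?r E P = \<zero>" if "P \<in> ?S" for P
    using form_val_mono[OF E(1,3) cS _ E(4)[OF that]] S that by blast
  have dE: "degree E \<le> ?r" using E(3) cS by simp
  have r: "?d + ?r = h + e" using d by simp
  let ?p = "a \<otimes>\<^bsub>poly_ring k\<^esub> E" and ?q = "b \<otimes>\<^bsub>poly_ring k\<^esub> E"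
  have "form_val k (h + e) ?p (Ps ! i) \<otimes> w1 i = form_val k (h + e) ?q (Ps ! i) \<otimes> w0 i" if i: "i < N" for i
  proof -
    note P = Ps_nth[OF i]
    have c: "form_val k ?d a (Ps ! i) \<in> carrier k" "form_val k ?d b (Ps ! i) \<in> carrier k"
      "form_val k ?r E (Ps ! i) \<in> carrier k" "w0 i \<in> carrier k" "w1 i \<in> carrier k"
      using form_val_closed lp E P w_closed[OF i] by auto
    have m: "form_val k (h + e) ?p (Ps ! i) = form_val k ?d a (Ps ! i) \<otimes> form_val k ?r E (Ps ! i)"
      "form_val k (h + e) ?q (Ps ! i) = form_val k ?d b (Ps ! i) \<otimes> form_val k ?r E (Ps ! i)"
      using form_val_mult[OF lp(2,5) E(1) dE P] form_val_mult[OF lp(3,6) E(1) dE P] r by auto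
    show ?thesis
    proof (cases "rf_eval k f (Ps ! i) = ws ! i")
      case True
      from rf_eval_cross[OF fr l P True] show ?thesis
        unfolding m using c by (metis m_assoc m_comm)
    next
      case False
      then have "form_val k ?r E (Ps ! i) = \<zero>" using E0 i by blast
      then show ?thesis unfolding m using c by simp
    qed
  qed
  moreover have "?q \<noteq> []" using mult_nonzero lp E by simp
  moreover have "degree ?p \<le> h + e" "degree ?q \<le> h + e"
    using degree_mult_le[OF lp(2) E(1)] degree_mult_le[OF lp(3) E(1)] lp(5,6) dE r by linarith+
  ultimately have "solution N Ps (h + e) w0 w1 ?p ?q"
    using lp E by (simp add: solution_def)
  then show ?thesis using \<open>?q \<noteq> []\<close> by blast
qed

text \<open>
  At the points where \<open>f\<close> agrees with the word, \<open>A / B\<close> and \<open>a / b\<close> are both proportional to the letter.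
  There are at least \<open>N - e\<close> such points, more than the degree \<open>h + e + d\<close> of the forms compared,
  where \<open>d \<le> h\<close> is the degree of \<open>f\<close>.
\<close>

lemma solution_cross_decoding:
  assumes f: "f \<in> decodings k Ps h e ws" and l: "lowest_terms k f = (a, b)"
    and s: "solution N Ps (h + e) w0 w1 A B"
  shows "A \<otimes>\<^bsub>poly_ring k\<^esub> b = B \<otimes>\<^bsub>poly_ring k\<^esub> a"
proof -
  let ?d = "rf_degree k f"
  have fr: "f \<in> rat_funs k" and d: "?d \<le> h"
    and err: "card {i. i < N \<and> rf_eval k f (Ps ! i) \<noteq> ws ! i} \<le> e"
    using f len by (auto simp: decodings_def)
  note lp = lowest_terms_props[OF fr l]
  let ?bad = "{i. i < N \<and> rf_eval k f (Ps ! i) \<noteq> ws ! i}"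
  let ?good = "{..<N} - ?bad"
  let ?S = "(\<lambda>i. Ps ! i) ` ?good"
  have "inj_on (\<lambda>i. Ps ! i) ?good"
    using dist len by (auto simp: inj_on_def nth_eq_iff_index_eq)
  then have "card ?S = card ?good" by (rule card_image)
  also have "\<dots> = N - card ?bad" by (subst card_Diff_subset) auto
  finally have cS: "card ?S > (h + e) + ?d" using err d bound by simp
  have S: "?S \<subseteq> proj_line k" using Ps_nth by auto
  have AB: "A \<in> Pol" "degree A \<le> h + e" "B \<in> Pol" "degree B \<le> h + e"
    using s by (auto simp: solution_def)
  show ?thesis
  proof (rule cross_eq[OF AB lp(2,5,3,6) S _ cS])
    fix P assume "P \<in> ?S"
    then obtain i where i: "i < N" "P = Ps ! i" "rf_eval k f (Ps ! i) = ws ! i" by auto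
    note P = Ps_nth[OF i(1)]
    show "form_val k (h + e) A P \<otimes> form_val k ?d b P = form_val k (h + e) B P \<otimes> form_val k ?d a P"
      unfolding i(2)
    proof (rule cross_trans[OF ws_nth[OF i(1)]])
      show "form_val k (h + e) A (Ps ! i) \<otimes> w1 i = form_val k (h + e) B (Ps ! i) \<otimes> w0 i"
        using s i(1) by (simp add: solution_def)
      show "form_val k ?d a (Ps ! i) \<otimes> w1 i = form_val k ?d b (Ps ! i) \<otimes> w0 i"
        by (rule rf_eval_cross[OF fr l P i(3)])
    qed (use form_val_closed AB lp P in auto)
  qed simp
qed

lemma solution_eq_decoding:
  assumes f: "f \<in> decodings k Ps h e ws" and s: "solution N Ps (h + e) w0 w1 A B"
  shows "frac k A B = f" "B \<noteq> []"
proof -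
  obtain a b where l: "lowest_terms k f = (a, b)" by force
  have fr: "f \<in> rat_funs k" using f by (simp add: decodings_def)
  note lp = lowest_terms_props[OF fr l]
  note c = solution_cross_decoding[OF f l s]
  have AB: "A \<in> Pol" "B \<in> Pol" "A \<noteq> [] \<or> B \<noteq> []" using s by (auto simp: solution_def)
  show "B \<noteq> []" using solution_denominator_nonzero[OF AB(1,2) lp(2,3,4) AB(3) c] .
  then show "frac k A B = f" by (rule frac_eq[OF fr lp(1) AB(1,2) _ c])
qed

text \<open>The fraction in lowest terms solves the second system, because \<open>A b = B a\<close> holds identically.\<close>

lemma reduced_solution_exists:
  assumes f: "f \<in> decodings k Ps h e ws" and s: "solution N Ps (h + e) w0 w1 A B"
  shows "\<exists>a b. solution N Ps h (\<lambda>i. form_val k (h + e) A (Ps ! i)) (\<lambda>i. form_val k (h + e) B (Ps ! i)) a b \<and> b \<noteq> []"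
proof -
  obtain a b where l: "lowest_terms k f = (a, b)" by force
  have fr: "f \<in> rat_funs k" and d: "rf_degree k f \<le> h" using f by (auto simp: decodings_def)
  note lp = lowest_terms_props[OF fr l]
  note c = solution_cross_decoding[OF f l s]
  have AB: "A \<in> Pol" "degree A \<le> h + e" "B \<in> Pol" "degree B \<le> h + e"
    using s by (auto simp: solution_def)
  have dab: "degree a \<le> h" "degree b \<le> h" using lp(5,6) d by auto
  have "form_val k h a (Ps ! i) \<otimes> form_val k (h + e) B (Ps ! i) =
     form_val k h b (Ps ! i) \<otimes> form_val k (h + e) A (Ps ! i)" if i: "i < N" for i
    using form_val_mult[OF AB(1,2) lp(3) dab(2) Ps_nth[OF i]] form_val_mult[OF AB(3,4) lp(2) dab(1) Ps_nth[OF i]]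
      c m_comm form_val_closed[OF _ Ps_nth[OF i]] AB lp(2,3) by metis
  then show ?thesis using lp dab by (auto simp: solution_def)
qed

text \<open>
  The second system makes \<open>a B\<close> and \<open>b A\<close> agree at all \<open>N\<close> points, including those where \<open>A\<close> and \<open>B\<close> both
  vanish, and \<open>N\<close> exceeds the degree \<open>2 * h + e\<close>.
\<close>

lemma reduced_solution_eq_decoding:
  assumes f: "f \<in> decodings k Ps h e ws" and s: "solution N Ps (h + e) w0 w1 A B"
    and r: "solution N Ps h (\<lambda>i. form_val k (h + e) A (Ps ! i)) (\<lambda>i. form_val k (h + e) B (Ps ! i)) a b"
  shows "frac k a b = f"
proof -
  have fr: "f \<in> rat_funs k" using f by (simp add: decodings_def)
  have AB: "A \<in> Pol" "degree A \<le> h + e" "B \<in> Pol" "degree B \<le> h + e"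
    using s by (auto simp: solution_def)
  have ab: "a \<in> Pol" "degree a \<le> h" "b \<in> Pol" "degree b \<le> h" "a \<noteq> [] \<or> b \<noteq> []"
    using r by (auto simp: solution_def)
  have c: "a \<otimes>\<^bsub>poly_ring k\<^esub> B = b \<otimes>\<^bsub>poly_ring k\<^esub> A"
  proof (rule cross_eq[OF ab(1-4) AB sub(1)])
    show "card (set Ps) > h + (h + e)" using distinct_card[OF dist] len bound by simp
    fix P assume "P \<in> set Ps"
    then obtain i where "i < N" "P = Ps ! i" using len by (auto simp: in_set_conv_nth)
    then show "form_val k h a P \<otimes> form_val k (h + e) B P = form_val k h b P \<otimes> form_val k (h + e) A P"
      using r by (simp add: solution_def)
  qed simp
  note AB' = solution_eq_decoding[OF f s]
  have "b \<noteq> []" using solution_denominator_nonzero[OF ab(1,3) AB(1,3) AB'(2) ab(5) c] .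
  moreover have "(A, B) \<in> f"
    using AB AB' unfolding AB'(1)[symmetric] frac_def by (simp add: frac_rel_def univ_poly_zero)
  ultimately show ?thesis using frac_eq[OF fr _ ab(1,3) _ c] by blast
qed

lemma start_state_in_field: "in_field k (start_state k Ps h e ws)"
  unfolding in_field_def start_state_def load_def
  using coord_closed[OF Ps_nth] coord_closed[OF ws_nth] len by auto

lemma decode_correct:
  assumes f: "f \<in> decodings k Ps h e ws"
  shows "\<exists>n s. exec k decode_prog (start_state k Ps h e ws) n s \<and> n \<le> 100 * N ^ 3 \<and> result k h s = f"
proof -
  let ?s = "start_state k Ps h e ws"
  let ?A = "\<lambda>g. read_poly k (h + e) g" and ?B = "\<lambda>g. read_poly k (h + e) (\<lambda>l. g (Suc (h + e) + l))"
  let ?u = "\<lambda>g i. homog_eval k (snd ?s ''P0'' i) (snd ?s ''P1'' i) g (h + e + 1)"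
  let ?w = "\<lambda>g i. homog_eval k (snd ?s ''P0'' i) (snd ?s ''P1'' i) (\<lambda>l. g (h + e + 1 + l)) (h + e + 1)"
  have inp: "snd ?s ''P0'' i = coord0 k (Ps ! i)" "snd ?s ''P1'' i = coord1 k (Ps ! i)"
    "snd ?s ''w0'' i = w0 i" "snd ?s ''w1'' i = w1 i" if "i < N" for i
    using that len by (auto simp: start_state_def load_def)
  have var: "fst ?s ''N'' = N" "fst ?s ''h'' = h" "fst ?s ''e'' = e" "snd ?s ''zero'' 0 = \<zero>"
    "snd ?s ''V1'' = (\<lambda>_. \<zero>)" "snd ?s ''V2'' = (\<lambda>_. \<zero>)"
    using len by (auto simp: start_state_def)
  have s1: "solves k N (snd ?s ''P0'') (snd ?s ''P1'') (snd ?s ''w0'') (snd ?s ''w1'') (h + e + 1) g \<longleftrightarrow>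
      solves_at N Ps (h + e) w0 w1 g" for g
    using solves_cong[of N, OF conjI[OF inp(1) conjI[OF inp(2) conjI[OF inp(3) inp(4)]]]] by simp
  have uw: "?u g i = form_val k (h + e) (?A g) (Ps ! i)" "?w g i = form_val k (h + e) (?B g) (Ps ! i)"
    if g: "range g \<subseteq> carrier k" and i: "i < N" for g i
  proof -
    have g2: "range (\<lambda>l. g (Suc (h + e) + l)) \<subseteq> carrier k" using g by auto
    show "?u g i = form_val k (h + e) (?A g) (Ps ! i)" "?w g i = form_val k (h + e) (?B g) (Ps ! i)"
      using homog_eval_form_val[OF g Ps_nth[OF i], of "h + e"] homog_eval_form_val[OF g2 Ps_nth[OF i], of "h + e"]
      by (simp_all add: inp[OF i] del: homog_eval.simps)
  qed
  let ?uf = "\<lambda>g i. form_val k (h + e) (?A g) (Ps ! i)" and ?wf = "\<lambda>g i. form_val k (h + e) (?B g) (Ps ! i)"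
  have s2: "solves k N (snd ?s ''P0'') (snd ?s ''P1'') (?u g) (?w g) (h + 1) g' \<longleftrightarrow>
      solves_at N Ps h (?uf g) (?wf g) g'" if "range g \<subseteq> carrier k" for g g'
    using solves_cong[of N, OF conjI[OF inp(1) conjI[OF inp(2) conjI[OF uw[OF that]]]]] by simp
  have uf: "?uf g i \<in> carrier k \<and> ?wf g i \<in> carrier k" if "range g \<subseteq> carrier k" "i < N" for g i
  proof -
    have "range (\<lambda>l. g (Suc (h + e) + l)) \<subseteq> carrier k" using that(1) by auto
    then show ?thesis using that form_val_closed[OF read_poly_closed Ps_nth] by blast
  qed
  have sol: "range g \<subseteq> carrier k" "solution N Ps (h + e) w0 w1 (?A g) (?B g)"
    if "solves_at N Ps (h + e) w0 w1 g" for g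
    using that solves_imp_solution[OF that Ps_nth w_closed] by (auto simp: solves_def)
  obtain p q where "solution N Ps (h + e) w0 w1 p q" "q \<noteq> []"
    using decoding_exists_solution[OF f] by blast
  then have ex1: "solves_at N Ps (h + e) w0 w1 (pair_vec (h + e) p q)"
    using solution_imp_solves Ps_nth w_closed by blast
  have ex2: "\<exists>g'. solves_at N Ps h (?uf g) (?wf g) g'" if g: "solves_at N Ps (h + e) w0 w1 g" for g
  proof -
    obtain a b where ab: "solution N Ps h (?uf g) (?wf g) a b" "b \<noteq> []"
      using reduced_solution_exists[OF f sol(2)[OF g]] by blast
    have "solves_at N Ps h (?uf g) (?wf g) (pair_vec h a b)"
      by (rule solution_imp_solves[OF ab]) (use Ps_nth uf[OF sol(1)[OF g]] in auto)
    then show ?thesis by blast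
  qed
  have "wp k decode_prog ?s (\<lambda>n t. n \<le> 100 * N ^ 3 \<and>
    (\<exists>g g'. solves k N (snd ?s ''P0'') (snd ?s ''P1'') (snd ?s ''w0'') (snd ?s ''w1'') (h + e + 1) g \<and>
       solves k N (snd ?s ''P0'') (snd ?s ''P1'') (?u g) (?w g) (h + 1) g' \<and>
       (\<forall>l<h + 1. snd t ''a'' l = g' l \<and> snd t ''b'' l = g' (h + 1 + l))))"
  proof (rule wp_decode[OF field_axioms start_state_in_field var(4,5,6) var(1)[symmetric] var(2)[symmetric] var(3)[symmetric]])
    show "h + e < N" using bound by simp
    show "solves k N (snd ?s ''P0'') (snd ?s ''P1'') (snd ?s ''w0'') (snd ?s ''w1'') (h + e + 1) (pair_vec (h + e) p q)"
      using ex1 s1 by blast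
    fix g assume "solves k N (snd ?s ''P0'') (snd ?s ''P1'') (snd ?s ''w0'') (snd ?s ''w1'') (h + e + 1) g"
    then have g: "solves_at N Ps (h + e) w0 w1 g" using s1 by blast
    show "\<exists>g'. solves k N (snd ?s ''P0'') (snd ?s ''P1'') (?u g) (?w g) (h + 1) g'"
      using ex2[OF g] s2[OF sol(1)[OF g]] by blast
  qed
  then obtain n t g g' where x: "exec k decode_prog ?s n t" "n \<le> 100 * N ^ 3"
    and g: "solves_at N Ps (h + e) w0 w1 g" and g': "solves_at N Ps h (?uf g) (?wf g) g'"
    and out: "\<And>l. l < h + 1 \<Longrightarrow> snd t ''a'' l = g' l \<and> snd t ''b'' l = g' (h + 1 + l)"
    unfolding wp_def using s1 s2 sol(1) by blast
  have "solution N Ps h (?uf g) (?wf g) (read_poly k h g') (read_poly k h (\<lambda>l. g' (Suc h + l)))"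
    using solves_imp_solution[OF g' Ps_nth uf[OF sol(1)[OF g]]] .
  from reduced_solution_eq_decoding[OF f sol(2)[OF g] this]
  have "frac k (read_poly k h g') (read_poly k h (\<lambda>l. g' (Suc h + l))) = f" .
  moreover have "read_poly k h (snd t ''a'') = read_poly k h g'"
    "read_poly k h (snd t ''b'') = read_poly k h (\<lambda>l. g' (Suc h + l))"
    unfolding read_poly_def using out by (auto intro!: arg_cong[of _ _ normalize])
  ultimately have "result k h t = f" by (simp add: result_def)
  with x show ?thesis by blast
qed

text \<open>The first system does not depend on \<open>f\<close>, and each of its solutions represents every decoding.\<close>

lemma decodings_unique:
  assumes f: "f \<in> decodings k Ps h e ws"
  shows "decodings k Ps h e ws = {f}"
proof -
  obtain p q where s: "solution N Ps (h + e) w0 w1 p q"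
    using decoding_exists_solution[OF f] by blast
  have "f' = f" if "f' \<in> decodings k Ps h e ws" for f'
    using solution_eq_decoding(1)[OF f s] solution_eq_decoding(1)[OF that s] by simp
  then show ?thesis using f by blast
qed

end

end

theorem mainTheorem7:
  shows "\<exists>(prog :: com) (C :: nat) (D :: nat).
    \<forall>(k :: 'a ring) (Ps :: 'a proj_pt list) (N :: nat) (h :: nat) (e :: nat) (ws :: 'a proj_pt list).
      field k \<longrightarrow> finite (carrier k) \<longrightarrow>
      length Ps = N \<longrightarrow> distinct Ps \<longrightarrow> set Ps \<subseteq> proj_line k \<longrightarrow>
      2 * (h + e) < N \<longrightarrow>
      length ws = N \<longrightarrow> set ws \<subseteq> proj_line k \<longrightarrow>
      decodings k Ps h e ws \<noteq> {} \<longrightarrow>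
      (\<exists>f. decodings k Ps h e ws = {f} \<and>
        (\<exists>n s. exec k prog (start_state k Ps h e ws) n s \<and> n \<le> C * N ^ D \<and> result k h s = f))"
proof (rule exI[of _ decode_prog], rule exI[of _ 100], rule exI[of _ 3], intro allI impI)
  fix k :: "'a ring" and Ps ws :: "'a proj_pt list" and N h e :: nat
  assume k: "field k" and a: "length Ps = N" "distinct Ps" "set Ps \<subseteq> proj_line k" "2 * (h + e) < N"
    "length ws = N" "set ws \<subseteq> proj_line k" and ne: "decodings k Ps h e ws \<noteq> {}"
  interpret base_field k by (rule base_field.intro) (rule k)
  obtain f where f: "f \<in> decodings k Ps h e ws" using ne by blast
  show "\<exists>f. decodings k Ps h e ws = {f} \<and>
      (\<exists>n s. exec k decode_prog (start_state k Ps h e ws) n s \<and> n \<le> 100 * N ^ 3 \<and> result k h s = f)"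
    using decodings_unique[OF a(1,5,2,3,6,4) f] decode_correct[OF a(1,5,2,3,6,4) f] by blast
qed

end
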